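(* Let $K$ be an algebraically closed field and let $d\ge 0$ and $n\ge d+1$ be integers. If $X\in\mathrm{Gr}(d+1,n)$ is a generic linear subspace of $K^n$, then the matroid of $L(X)$ equals the relabeled Dilworth truncation $\widetilde{\mathrm{D}}_{n-d}(U_{n,n})$ of the free matroid $U_{n,n}$. That is, a collection of $d$-subsets $J_1,\dots,J_m$ of $[n]$ is independent in the matroid of $L(X)$ if and only if for any $s>0$ and any $s$-element set $\{j_1,\dots,j_s\}\subset[m]$ one has $\left|\bigcap_{l=1}^s J_{j_l}\right|\le d+1-s$.
   Context: $[n]=\{1,\dots,n\}$ and $\binom{[n]}{m}$ is the set of $m$-element subsets of $[n]$. $\mathrm{Gr}(m,n)$ is the Grassmannian of $m$-dimensional subspaces of $K^n$ in its Plücker embedding into $\mathbb{P}^{\binom{n}{m}-1}$. For a $(d+1)$-dimensional subspace $X\subset K^n$, $L(X)\subset\mathrm{Gr}(d,n)\subset\mathbb{P}^{\binom{n}{d}-1}$ is the set of points corresponding to $d$-dimensional subspaces contained in $X$; it is a $d$-dimensional projective linear subspace. The matroid of a linear subspace $L\subset K^E$ (or its projectivization) is the matroid on $E$ of linear dependencies among the columns of any matrix with rowspace $L$; so the matroid of $L(X)$ has ground set $\binom{[n]}{d}$. Generic: if $X$ is the rowspace of $W\in K^{(d+1)\times n}$, then $L(X)$ is the rowspace of the $(d+1)\times\binom{n}{d}$ matrix $V$ with $V_{i,J}=(-1)^{i+1}\det(W_{-i}^J)$ ($W_{-i}^J$: rows $[d+1]\setminus\{i\}$, columns $J$). $X$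 is called generic if every maximal minor of $V$ that is not identically zero (as $X$ varies over $\mathrm{Gr}(d+1,n)$) is nonzero for this $X$. Generic subspaces form a Zariski open dense subset of $\mathrm{Gr}(d+1,n)$ on which the matroid of $L(X)$ is constant. Dilworth truncation: for a rank-$e$ matroid $M$ on $[n]$ and $1\le k\le e$, $\mathrm{D}_k(M)$ is the matroid of rank $e-k+1$ whose ground set is the set of rank-$k$ flats of $M$, and whose independent sets are the sets $\{J_1,\dots,J_m\}$ such that for any $s>0$ and any $s$-element $\{j_1,\dots,j_s\}\subset[m]$ the union $\bigcup_{l=1}^s J_{j_l}$ has rank at least $s+k-1$ in $M$. $U_{n,n}$ is the free matroid on $[n]$ (all subsets independent). $\widetilde{\mathrm{D}}_k(U_{n,n})$ is the matroid on the $(n-k)$-subsets of $[n]$ obtained from $\mathrm{D}_k(U_{n,n})$ by relabeling each element by its complement in $[n]$; a collection $J_1,\dots,J_m$ of $(n-k)$-subsets is independent in it iff $|\bigcap_{l=1}^sJ_{j_l}|\le n-k+1-s$ for every $s>0$ and every $s$-element $\{j_1,\dots,j_s\}\subset[m]$. *)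

theory Defs
  imports
    "HOL-Library.Function_Algebras"
    "HOL-Library.Ramsey"
    "Jordan_Normal_Form.Determinant"
begin

section \<open>The coordinate spaces K^E\<close>

definition fscale :: "'a::field \<Rightarrow> ('i \<Rightarrow> 'a) \<Rightarrow> 'i \<Rightarrow> 'a"
  where "fscale c v = (\<lambda>x. c * v x)"

interpretation fs: vector_space "fscale :: 'a::field \<Rightarrow> ('i \<Rightarrow> 'a) \<Rightarrow> 'i \<Rightarrow> 'a"
  by unfold_locales (auto simp: fscale_def fun_eq_iff algebra_simps)

definition coord_space :: "'i set \<Rightarrow> ('i \<Rightarrow> 'a::field) set"
  where "coord_space E = {v. \<forall>x. x \<notin> E \<longrightarrow> v x = 0}"

text \<open>An r-row matrix with columns indexed by E is a function A, where A i j is the entry in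
  row i (between 1 and r) and column j; rows with other indices are ignored.\<close>

definition is_matrix :: "nat \<Rightarrow> 'e set \<Rightarrow> (nat \<Rightarrow> 'e \<Rightarrow> 'a::field) \<Rightarrow> bool"
  where "is_matrix r E A \<longleftrightarrow> (\<forall>i\<in>{1..r}. A i \<in> coord_space E)"

definition row_space :: "nat \<Rightarrow> (nat \<Rightarrow> 'e \<Rightarrow> 'a::field) \<Rightarrow> ('e \<Rightarrow> 'a) set"
  where "row_space r A = fs.span (A ` {1..r})"

definition column :: "nat \<Rightarrow> (nat \<Rightarrow> 'e \<Rightarrow> 'a::field) \<Rightarrow> 'e \<Rightarrow> nat \<Rightarrow> 'a"
  where "column r A j = (\<lambda>i. if i \<in> {1..r} then A i j else 0)"

text \<open>The minor with the rows and columns taken in the order in which they are listed.\<close>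

definition minor :: "('r \<Rightarrow> 'c \<Rightarrow> 'a::field) \<Rightarrow> 'r list \<Rightarrow> 'c list \<Rightarrow> 'a"
  where "minor A rs cs = det (mat (length rs) (length cs) (\<lambda>(a, b). A (rs ! a) (cs ! b)))"


section \<open>Matroids\<close>

record 'e matroid =
  ground :: "'e set"
  indep :: "'e set set"

definition is_matroid :: "'e matroid \<Rightarrow> bool"
  where "is_matroid M \<longleftrightarrow>
    finite (ground M) \<and> indep M \<subseteq> Pow (ground M) \<and> {} \<in> indep M \<and>
    (\<forall>I\<in>indep M. \<forall>I'\<subseteq>I. I' \<in> indep M) \<and>
    (\<forall>I\<in>indep M. \<forall>I'\<in>indep M. card I < card I' \<longrightarrow> (\<exists>x\<in>I' - I. insert x I \<in> indep M))"

definition rk :: "'e matroid \<Rightarrow> 'e set \<Rightarrow> nat"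
  where "rk M A = Max (card ` {I \<in> indep M. I \<subseteq> A})"

definition flat :: "'e matroid \<Rightarrow> 'e set \<Rightarrow> bool"
  where "flat M F \<longleftrightarrow> F \<subseteq> ground M \<and> (\<forall>x\<in>ground M - F. rk M F < rk M (insert x F))"

definition free_matroid :: "'e set \<Rightarrow> 'e matroid"
  where "free_matroid E = \<lparr>ground = E, indep = Pow E\<rparr>"

definition relabel :: "('e \<Rightarrow> 'f) \<Rightarrow> 'e matroid \<Rightarrow> 'f matroid"
  where "relabel f M = \<lparr>ground = f ` ground M, indep = image f ` indep M\<rparr>"

definition dilworth :: "nat \<Rightarrow> 'e matroid \<Rightarrow> 'e set matroid"
  where "dilworth k M =
    (let G = {F. flat M F \<and> rk M F = k} in
      \<lparr>ground = G,
       indep = {\<J>. \<J> \<subseteq> G \<and>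
         (\<forall>s>0. \<forall>\<S>\<subseteq>\<J>. card \<S> = s \<longrightarrow> rk M (\<Union>\<S>) \<ge> s + k - 1)}\<rparr>)"

definition dilworth_compl :: "nat \<Rightarrow> nat \<Rightarrow> nat set matroid"
  where "dilworth_compl k n = relabel (\<lambda>J. {1..n} - J) (dilworth k (free_matroid {1..n}))"

text \<open>The columns are required to be independent as a family, hence the injectivity. Which
  matrix with row space L is used does not matter, see \<open>indep_linear_matroid_row_space\<close>.\<close>

definition linear_matroid :: "'e set \<Rightarrow> ('e \<Rightarrow> 'a::field) set \<Rightarrow> 'e matroid"
  where "linear_matroid E L =
    \<lparr>ground = E,
     indep = {J. J \<subseteq> E \<and> (\<exists>r A. is_matrix r E A \<and> row_space r A = L \<and>
       inj_on (column r A) J \<and> fs.independent (column r A ` J))}\<rparr>"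


section \<open>Grassmannians and the linear spaces L(X)\<close>

definition Gr :: "nat \<Rightarrow> nat \<Rightarrow> (nat \<Rightarrow> 'a::field) set set"
  where "Gr m n = {X. fs.subspace X \<and> X \<subseteq> coord_space {1..n} \<and> fs.dim X = m}"

definition plucker_vector :: "nat \<Rightarrow> nat \<Rightarrow> (nat \<Rightarrow> nat \<Rightarrow> 'a::field) \<Rightarrow> nat set \<Rightarrow> 'a"
  where "plucker_vector m n A =
    (\<lambda>J. if J \<in> nsets {1..n} m then minor A [1..<m+1] (sorted_list_of_set J) else 0)"

text \<open>A point of a projective space is represented by the line (one-dimensional subspace) it
  stands for; the next definition is the Pluecker embedding.\<close>

definition plucker :: "nat \<Rightarrow> nat \<Rightarrow> (nat \<Rightarrow> 'a::field) set \<Rightarrow> (nat set \<Rightarrow> 'a) set"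
  where "plucker m n Y =
    {fscale c (plucker_vector m n A) | c A. is_matrix m {1..n} A \<and> row_space m A = Y}"

definition L_space :: "nat \<Rightarrow> nat \<Rightarrow> (nat \<Rightarrow> 'a::field) set \<Rightarrow> (nat set \<Rightarrow> 'a) set set"
  where "L_space d n X = plucker d n ` {Y \<in> Gr d n. Y \<subseteq> X}"

text \<open>The union of the lines in L(X) is the linear subspace whose projectivization is L(X).\<close>

definition matroid_of_L :: "nat \<Rightarrow> nat \<Rightarrow> (nat \<Rightarrow> 'a::field) set \<Rightarrow> nat set matroid"
  where "matroid_of_L d n X = linear_matroid (nsets {1..n} d) (\<Union> (L_space d n X))"

definition V_matrix :: "nat \<Rightarrow> nat \<Rightarrow> (nat \<Rightarrow> nat \<Rightarrow> 'a::field) \<Rightarrow> nat \<Rightarrow> nat set \<Rightarrow> 'a"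
  where "V_matrix d n W = (\<lambda>i J. if J \<in> nsets {1..n} d then
      (-1) ^ (i + 1) * minor W (sorted_list_of_set ({1..d+1} - {i})) (sorted_list_of_set J) else 0)"

text \<open>A maximal minor of V is given by a list of d+1 distinct columns; reordering the list
  only changes the sign. Replacing W by another matrix with row space X multiplies all maximal
  minors by the same nonzero scalar.\<close>

definition generic :: "nat \<Rightarrow> nat \<Rightarrow> (nat \<Rightarrow> 'a::field) set \<Rightarrow> bool"
  where "generic d n X \<longleftrightarrow> X \<in> Gr (d+1) n \<and>
    (\<forall>W. is_matrix (d+1) {1..n} W \<and> row_space (d+1) W = X \<longrightarrow>
      (\<forall>Js. distinct Js \<and> length Js = d+1 \<and> set Js \<subseteq> nsets {1..n} d \<and>
         (\<exists>X'\<in>Gr (d+1) n. \<exists>W' :: nat \<Rightarrow> nat \<Rightarrow> 'a.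
            is_matrix (d+1) {1..n} W' \<and> row_space (d+1) W' = X' \<and>
            minor (V_matrix d n W') [1..<d+2] Js \<noteq> 0) \<longrightarrow>
         minor (V_matrix d n W) [1..<d+2] Js \<noteq> 0))"


section \<open>Consistency of the definitions\<close>

lemma fs_sum_apply: "(\<Sum>x\<in>S. f x) i = (\<Sum>x\<in>S. f x i)"
  for f :: "'b \<Rightarrow> 'i \<Rightarrow> 'a::field"
  by (induction S rule: infinite_finite_induct) auto

lemma column_family_independent_iff:
  fixes A :: "nat \<Rightarrow> 'b \<Rightarrow> 'a::field"
  assumes "finite J"
  shows "inj_on (column r A) J \<and> fs.independent (column r A ` J) \<longleftrightarrow>
    (\<forall>c. (\<forall>v\<in>row_space r A. (\<Sum>j\<in>J. c j * v j) = 0) \<longrightarrow> (\<forall>j\<in>J. c j = 0))"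
    (is "?L \<longleftrightarrow> ?R")
proof -
  let ?f = "column r A"
  have rel: "(\<forall>v\<in>row_space r A. (\<Sum>j\<in>J. c j * v j) = 0) \<longleftrightarrow> (\<Sum>j\<in>J. fscale (c j) (?f j)) = 0"
    for c :: "'b \<Rightarrow> 'a"
  proof
    assume h: "\<forall>v\<in>row_space r A. (\<Sum>j\<in>J. c j * v j) = 0"
    have "(\<Sum>j\<in>J. c j * A i j) = 0" if "i \<in> {1..r}" for i
      using h that unfolding row_space_def by (meson fs.span_base image_eqI)
    then have "(\<Sum>j\<in>J. fscale (c j) (?f j)) i = 0" for i
      by (cases "i \<in> {1..r}")
        (simp_all only: fs_sum_apply fscale_def column_def if_True if_False mult_zero_right sum.neutral_const)
    then show "(\<Sum>j\<in>J. fscale (c j) (?f j)) = 0"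
      by (simp add: fun_eq_iff)
  next
    assume h: "(\<Sum>j\<in>J. fscale (c j) (?f j)) = 0"
    have rows: "(\<Sum>j\<in>J. c j * A i j) = 0" if i: "i \<in> {1..r}" for i
    proof -
      have "(\<Sum>j\<in>J. fscale (c j) (?f j)) i = 0" by (simp add: h)
      then show ?thesis using i by (simp add: fs_sum_apply fscale_def column_def)
    qed
    have "fs.subspace {v. (\<Sum>j\<in>J. c j * v j) = 0}"
      by (rule fs.subspaceI)
        (auto simp: fscale_def algebra_simps sum.distrib simp flip: sum_distrib_left)
    then have "row_space r A \<subseteq> {v. (\<Sum>j\<in>J. c j * v j) = 0}"
      unfolding row_space_def using rows by (intro fs.span_minimal) auto
    then show "\<forall>v\<in>row_space r A. (\<Sum>j\<in>J. c j * v j) = 0" by blast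
  qed
  have "?L \<longleftrightarrow> (\<forall>c. (\<Sum>j\<in>J. fscale (c j) (?f j)) = 0 \<longrightarrow> (\<forall>j\<in>J. c j = 0))" (is "_ \<longleftrightarrow> ?M")
  proof
    assume L: ?L
    show ?M
    proof (intro allI impI ballI)
      fix c j assume z: "(\<Sum>j\<in>J. fscale (c j) (?f j)) = 0" and j: "j \<in> J"
      have "(\<Sum>v\<in>?f ` J. fscale (c (the_inv_into J ?f v)) v) = (\<Sum>j\<in>J. fscale (c j) (?f j))"
        using L by (subst sum.reindex) (auto simp: the_inv_into_f_f intro!: sum.cong)
      then have "c (the_inv_into J ?f (?f j)) = 0"
        using z L j assms
          fs.independent_explicit_module[of "?f ` J", THEN iffD1, rule_format,
            of "?f ` J" "\<lambda>v. c (the_inv_into J ?f v)" "?f j"]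
        by auto
      then show "c j = 0" using L j by (simp add: the_inv_into_f_f)
    qed
  next
    assume M: ?M
    have inj: "inj_on ?f J"
    proof (rule inj_onI, rule ccontr)
      fix x y assume xy: "x \<in> J" "y \<in> J" "?f x = ?f y" "x \<noteq> y"
      define c :: "'b \<Rightarrow> 'a" where "c = (\<lambda>j. if j = x then 1 else if j = y then - 1 else 0)"
      have "(\<Sum>j\<in>J. fscale (c j) (?f j)) = (\<Sum>j\<in>{x, y}. fscale (c j) (?f j))"
        by (rule sum.mono_neutral_right) (use assms xy in \<open>auto simp: c_def fscale_def fun_eq_iff\<close>)
      also have "\<dots> = 0" using xy by (auto simp: c_def fscale_def fun_eq_iff)
      finally have "c x = 0" using M xy(1) by blast
      then show False by (simp add: c_def)
    qed
    moreover have "fs.independent (?f ` J)"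
      unfolding fs.independent_explicit_module
    proof (intro allI impI)
      fix t u v
      assume t: "finite t" "t \<subseteq> ?f ` J" "(\<Sum>v\<in>t. fscale (u v) v) = 0" "v \<in> t"
      define c :: "'b \<Rightarrow> 'a" where "c = (\<lambda>j. if ?f j \<in> t then u (?f j) else 0)"
      have "(\<Sum>j\<in>J. fscale (c j) (?f j)) =
          (\<Sum>v\<in>?f ` J. fscale (if v \<in> t then u v else 0) v)"
        using inj by (subst sum.reindex) (auto simp: c_def)
      also have "\<dots> = (\<Sum>v\<in>t. fscale (u v) v)"
        by (rule sum.mono_neutral_cong_right) (use assms t in \<open>auto simp: fscale_def fun_eq_iff\<close>)
      finally have "\<forall>j\<in>J. c j = 0" using M t by simp
      then show "u v = 0" using t unfolding c_def by force
    qed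
    ultimately show ?L by simp
  qed
  then show ?thesis by (simp add: rel)
qed

lemma indep_linear_matroid_row_space:
  assumes "finite E" "is_matrix r E A"
  shows "J \<in> indep (linear_matroid E (row_space r A)) \<longleftrightarrow>
    J \<subseteq> E \<and> inj_on (column r A) J \<and> fs.independent (column r A ` J)"
proof (cases "J \<subseteq> E")
  case True
  then have "finite J" using assms(1) finite_subset by blast
  then show ?thesis
    unfolding linear_matroid_def using assms(2) True
    by (auto simp: column_family_independent_iff)
qed (simp add: linear_matroid_def)

lemma is_matroid_linear_matroid:
  assumes E: "finite E" and A: "is_matrix r E A"
  shows "is_matroid (linear_matroid E (row_space r A))"
proof -
  let ?f = "column r A"
  note iff = indep_linear_matroid_row_space[OF E A]
  have aug: "\<exists>x\<in>I' - I. insert x I \<subseteq> E \<and> inj_on ?f (insert x I) \<and> fs.independent (?f ` insert x I)"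
    if I: "I \<subseteq> E" "inj_on ?f I" "fs.independent (?f ` I)"
      and I': "I' \<subseteq> E" "inj_on ?f I'" "fs.independent (?f ` I')" and c: "card I < card I'" for I I'
  proof -
    have fin: "finite I" using I(1) E finite_subset by blast
    have "\<not> ?f ` I' \<subseteq> fs.span (?f ` I)"
    proof
      assume "?f ` I' \<subseteq> fs.span (?f ` I)"
      with fs.independent_span_bound[OF _ I'(3), of "?f ` I"] fin
      have "card (?f ` I') \<le> card (?f ` I)" by simp
      with c I(2) I'(2) show False by (simp add: card_image)
    qed
    then obtain x where x: "x \<in> I'" "?f x \<notin> fs.span (?f ` I)" by blast
    then have "?f x \<notin> ?f ` I" using fs.span_base by blast
    with x I I' show ?thesis by (intro bexI[of _ x]) (auto simp: fs.independent_insert)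
  qed
  have ground: "ground (linear_matroid E (row_space r A)) = E" by (simp add: linear_matroid_def)
  show ?thesis
    unfolding is_matroid_def ground
  proof (intro conjI ballI allI impI)
    fix I I' assume "I \<in> indep (linear_matroid E (row_space r A))" "I' \<subseteq> I"
    then show "I' \<in> indep (linear_matroid E (row_space r A))"
      unfolding iff by (meson fs.independent_mono image_mono inj_on_subset subset_trans)
  next
    fix I I'
    assume "I \<in> indep (linear_matroid E (row_space r A))"
      "I' \<in> indep (linear_matroid E (row_space r A))" "card I < card I'"
    then show "\<exists>x\<in>I' - I. insert x I \<in> indep (linear_matroid E (row_space r A))"
      unfolding iff using aug by blast
  qed (use E in \<open>auto simp: iff fs.independent_empty\<close>)
qed

lemma is_matroid_free_matroid: "finite E \<Longrightarrow> is_matroid (free_matroid E)"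
  unfolding is_matroid_def free_matroid_def
proof (intro conjI ballI allI impI)
  fix I I' assume I: "finite E" "I \<in> indep \<lparr>ground = E, indep = Pow E\<rparr>"
    "I' \<in> indep \<lparr>ground = E, indep = Pow E\<rparr>" "card I < card I'"
  have "\<not> I' \<subseteq> I"
    using I card_mono[of I I'] finite_subset[of I E] by auto
  then show "\<exists>x\<in>I' - I. insert x I \<in> indep \<lparr>ground = E, indep = Pow E\<rparr>"
    using I by auto
qed auto

lemma rk_free_matroid: "finite E \<Longrightarrow> A \<subseteq> E \<Longrightarrow> rk (free_matroid E) A = card A"
  unfolding rk_def free_matroid_def
  by (rule Max_eqI) (auto dest: finite_subset intro: card_mono)

lemma ground_dilworth_compl:
  assumes "k \<le> n"
  shows "ground (dilworth_compl k n) = nsets {1..n} (n - k)"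
proof -
  have "flat (free_matroid {1..n}) F \<longleftrightarrow> F \<subseteq> {1..n}" for F
  proof -
    have "rk (free_matroid {1..n}) F < rk (free_matroid {1..n}) (insert x F)"
      if "F \<subseteq> {1..n}" "x \<in> {1..n} - F" for x
      using that finite_subset[OF that(1)] by (subst (1 2) rk_free_matroid) auto
    then show ?thesis by (auto simp: flat_def) (auto simp: free_matroid_def)
  qed
  then have "ground (dilworth_compl k n) = (\<lambda>J. {1..n} - J) ` {F. F \<subseteq> {1..n} \<and> card F = k}"
    by (auto simp: dilworth_compl_def relabel_def dilworth_def Let_def rk_free_matroid)
  also have "\<dots> = nsets {1..n} (n - k)"
  proof (intro equalityI subsetI)
    fix J assume "J \<in> nsets {1..n} (n - k)"
    then have "J = {1..n} - ({1..n} - J)" "card ({1..n} - J) = k"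
      using assms by (auto simp: nsets_def card_Diff_subset)
    then show "J \<in> (\<lambda>J. {1..n} - J) ` {F. F \<subseteq> {1..n} \<and> card F = k}" by blast
  qed (auto simp: nsets_def card_Diff_subset finite_subset)
  finally show ?thesis .
qed

end

theory Submission
  imports Defs
begin

text \<open>If X is the row space of W, then L(X) is the row space of V, and column J of V is the linear
  form sending c to the determinant of \<open>[c | W\<^sup>J]\<close>. It vanishes on the columns j of W with j in J,
  so s independent columns of V whose index sets share t elements satisfy \<open>s + t \<le> d + 1\<close>.

  Conversely, given sets \<open>Z\<^sub>1, \<dots>, Z\<^sub>m\<close> that satisfy the intersection condition, consider matrices G
  whose row i vanishes on \<open>Z\<^sub>i\<close> for \<open>i \<le> m\<close>. For such G, column \<open>Z\<^sub>i\<close> of V is a multiple of the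
  i-th unit vector, and the intersection condition is exactly Hall's condition for the scalar to be a
  polynomial in the entries of G that is not identically zero. As the field is infinite, some G makes
  all these scalars nonzero, so that the columns are independent. They extend to a nonzero maximal
  minor of V for G, which by genericity is nonzero for W as well.\<close>


section \<open>Minors\<close>

lemma minor_transpose:
  assumes "length cs = length rs"
  shows "minor (\<lambda>j i. A i j) cs rs = minor A rs cs"
proof -
  have "mat (length cs) (length rs) (\<lambda>(a, b). A (rs ! b) (cs ! a)) =
      transpose_mat (mat (length rs) (length cs) (\<lambda>(a, b). A (rs ! a) (cs ! b)))"
    by (rule eq_matI) auto
  then show ?thesis unfolding minor_def using assms by (subst det_transpose[symmetric]) auto
qed

text \<open>A square matrix over a field is singular iff it kills a nonzero vector. As
  \<open>cs\<close> is distinct, such a vector is a function \<open>k\<close> on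
  \<open>set cs\<close>, and \<open>rs\<close> and \<open>cs\<close> enter the criterion only as
  sets, so the order of the columns becomes irrelevant.\<close>

lemma minor_nonzero_iff:
  fixes A :: "'r \<Rightarrow> 'c \<Rightarrow> 'a::field"
  assumes "distinct cs" "length cs = length rs"
  shows "minor A rs cs \<noteq> 0 \<longleftrightarrow>
    (\<forall>k. (\<forall>r\<in>set rs. (\<Sum>y\<in>set cs. k y * A r y) = 0) \<longrightarrow> (\<forall>y\<in>set cs. k y = 0))"
proof -
  define n where "n = length rs"
  define M where "M = mat n n (\<lambda>(a, b). A (rs ! a) (cs ! b))"
  have M: "M \<in> carrier_mat n n" by (simp add: M_def)
  have minor: "minor A rs cs = det M" using assms by (simp add: minor_def M_def n_def)
  have bij: "bij_betw ((!) cs) {0..<n} (set cs)"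
    using bij_betw_nth[OF assms(1), of "{0..<n}" "set cs"] assms(2)
    by (simp add: n_def lessThan_atLeast0)
  have row: "(M *\<^sub>v v) $ a = (\<Sum>b\<in>{0..<n}. v $ b * A (rs ! a) (cs ! b))"
    if "a < n" "v \<in> carrier_vec n" for a v
    using that by (auto simp: M_def scalar_prod_def mult.commute intro!: sum.cong)
  have sum: "(\<Sum>y\<in>set cs. k y * A r y) = (\<Sum>b\<in>{0..<n}. k (cs ! b) * A r (cs ! b))" for k r
    using sum.reindex_bij_betw[OF bij, of "\<lambda>y. k y * A r y"] by simp
  have "(\<exists>v. v \<in> carrier_vec n \<and> v \<noteq> 0\<^sub>v n \<and> M *\<^sub>v v = 0\<^sub>v n) \<longleftrightarrow>
    (\<exists>k. (\<forall>r\<in>set rs. (\<Sum>y\<in>set cs. k y * A r y) = 0) \<and> (\<exists>y\<in>set cs. k y \<noteq> 0))"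
  proof
    assume "\<exists>v. v \<in> carrier_vec n \<and> v \<noteq> 0\<^sub>v n \<and> M *\<^sub>v v = 0\<^sub>v n"
    then obtain v where v: "v \<in> carrier_vec n" "v \<noteq> 0\<^sub>v n" "M *\<^sub>v v = 0\<^sub>v n" by blast
    define k where "k y = v $ (inv_into {0..<n} ((!) cs) y)" for y
    have k: "k (cs ! b) = v $ b" if "b < n" for b
      using bij_betw_inv_into_left[OF bij, of b] that by (simp add: k_def)
    have "(\<Sum>y\<in>set cs. k y * A r y) = 0" if r: "r \<in> set rs" for r
    proof -
      obtain a where a: "a < n" "r = rs ! a" using r by (auto simp: in_set_conv_nth n_def)
      have "(M *\<^sub>v v) $ a = 0" using v(3) a(1) by simp
      then show ?thesis using row[OF a(1) v(1)] k a(2) by (simp add: sum)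
    qed
    moreover obtain b where "b < n" "v $ b \<noteq> 0"
      using v(1,2) by (metis carrier_vecD eq_vecI index_zero_vec)
    ultimately show "\<exists>k. (\<forall>r\<in>set rs. (\<Sum>y\<in>set cs. k y * A r y) = 0) \<and> (\<exists>y\<in>set cs. k y \<noteq> 0)"
      using k assms(2) by (intro exI[of _ k]) (auto simp: n_def intro!: bexI[of _ "cs ! b"])
  next
    assume "\<exists>k. (\<forall>r\<in>set rs. (\<Sum>y\<in>set cs. k y * A r y) = 0) \<and> (\<exists>y\<in>set cs. k y \<noteq> 0)"
    then obtain k y where k: "\<forall>r\<in>set rs. (\<Sum>y\<in>set cs. k y * A r y) = 0" "y \<in> set cs" "k y \<noteq> 0"
      by blast
    define v where "v = vec n (\<lambda>b. k (cs ! b))"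
    have v: "v \<in> carrier_vec n" by (simp add: v_def)
    have "M *\<^sub>v v = 0\<^sub>v n"
    proof (rule eq_vecI)
      fix a assume "a < dim_vec (0\<^sub>v n :: 'a vec)"
      then have a: "a < n" by simp
      have "(M *\<^sub>v v) $ a = (\<Sum>y\<in>set cs. k y * A (rs ! a) y)"
        unfolding row[OF a v] sum by (simp add: v_def)
      then show "(M *\<^sub>v v) $ a = 0\<^sub>v n $ a" using k(1) a by (simp add: n_def)
    qed (simp add: M_def)
    moreover obtain b where "b < n" "y = cs ! b"
      using k(2) assms(2) by (auto simp: in_set_conv_nth n_def)
    then have "v \<noteq> 0\<^sub>v n" using k(3) by (metis index_vec index_zero_vec(1) v_def)
    ultimately show "\<exists>v. v \<in> carrier_vec n \<and> v \<noteq> 0\<^sub>v n \<and> M *\<^sub>v v = 0\<^sub>v n" using v by blast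
  qed
  then show ?thesis unfolding minor using det_0_iff_vec_prod_zero_field[OF M] by auto
qed

lemma minor_nonzero_iff_same_columns:
  fixes A :: "'r \<Rightarrow> 'c \<Rightarrow> 'a::field"
  assumes "distinct cs" "distinct cs'" "set cs = set cs'" "length cs' = length rs"
  shows "minor A rs cs \<noteq> 0 \<longleftrightarrow> minor A rs cs' \<noteq> 0"
proof -
  have "length cs = length rs" using assms distinct_card by metis
  then show ?thesis using assms by (simp add: minor_nonzero_iff)
qed

lemma minor_nonzero_iff_rows:
  fixes A :: "'r \<Rightarrow> 'c \<Rightarrow> 'a::field"
  assumes "distinct rs" "length cs = length rs"
  shows "minor A rs cs \<noteq> 0 \<longleftrightarrow>
    (\<forall>k. (\<forall>y\<in>set cs. (\<Sum>r\<in>set rs. k r * A r y) = 0) \<longrightarrow> (\<forall>r\<in>set rs. k r = 0))"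
  using minor_nonzero_iff[OF assms(1), of cs "\<lambda>j i. A i j"] minor_transpose[OF assms(2), of A] assms(2)
  by simp

text \<open>Padding a homogeneous system that has too few equations with zero equations makes it
  square, and its determinant vanishes.\<close>

lemma ex_nontrivial_solution:
  fixes u :: "'b \<Rightarrow> 'c \<Rightarrow> 'a::field"
  assumes "finite B" "finite S" "card B < card S"
  shows "\<exists>k. (\<exists>y\<in>S. k y \<noteq> 0) \<and> (\<forall>b\<in>B. (\<Sum>y\<in>S. k y * u b y) = 0)"
proof -
  obtain bs where bs: "set bs = B" "distinct bs" using finite_distinct_list[OF assms(1)] by blast
  obtain cs where cs: "set cs = S" "distinct cs" using finite_distinct_list[OF assms(2)] by blast
  \<comment> \<open>\<open>None\<close> stands for the zero equation. One copy comes first, so that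
    row 0 is surely zero; the others bring the number of rows up to
    \<open>length cs\<close>.\<close>
  define rs where "rs = None # map Some bs @ replicate (length cs - length bs - 1) None"
  define A where "A r y = (case r of None \<Rightarrow> 0 | Some b \<Rightarrow> u b y)" for r y
  have len: "length cs = length rs"
    using assms(3) bs cs by (auto simp: rs_def distinct_card)
  have rs: "0 < length rs" "rs ! 0 = None" by (simp_all add: rs_def)
  have "minor A rs cs = 0"
    unfolding minor_def
  proof (subst det_def'[where n = "length rs"])
    show "(\<Sum>p\<in>{p. p permutes {0..<length rs}}. signof p * (\<Prod>i = 0..<length rs.
        mat (length rs) (length cs) (\<lambda>(a, b). A (rs ! a) (cs ! b)) $$ (i, p i))) = 0"
    proof (intro sum.neutral ballI)
      fix p assume "p \<in> {p. p permutes {0..<length rs}}"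
      then have "p 0 < length rs" using permutes_in_image[of p "{0..<length rs}" 0] rs(1) by auto
      then have "mat (length rs) (length cs) (\<lambda>(a, b). A (rs ! a) (cs ! b)) $$ (0, p 0) = 0"
        using len rs by (simp add: A_def)
      then have "(\<Prod>i = 0..<length rs.
          mat (length rs) (length cs) (\<lambda>(a, b). A (rs ! a) (cs ! b)) $$ (i, p i)) = 0"
        using rs(1) by (intro prod_zero) auto
      then show "signof p * (\<Prod>i = 0..<length rs.
          mat (length rs) (length cs) (\<lambda>(a, b). A (rs ! a) (cs ! b)) $$ (i, p i)) = 0" by simp
    qed
  qed (use len in simp)
  then obtain k where "\<forall>r\<in>set rs. (\<Sum>y\<in>S. k y * A r y) = 0" "\<exists>y\<in>S. k y \<noteq> 0"
    using minor_nonzero_iff[OF cs(2) len, of A] cs(1) by auto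
  moreover have "(\<Sum>y\<in>S. k y * u b y) = (\<Sum>y\<in>S. k y * A (Some b) y)" for b by (simp add: A_def)
  ultimately show ?thesis using bs(1) by (intro exI[of _ k]) (auto simp: rs_def)
qed

section \<open>Polynomial behaviour of minors and simultaneous nonvanishing\<close>

text \<open>The polynomial is the determinant of the matrix with entries
  \<open>[:G i j, H i j:]\<close>: evaluation at \<open>t\<close> is a ring homomorphism and so
  commutes with determinants.\<close>

lemma ex_poly_minor_line:
  fixes G H :: "'r \<Rightarrow> 'c \<Rightarrow> 'a::field"
  shows "\<exists>p. \<forall>t. poly p t = minor (\<lambda>i j. G i j + t * H i j) rs cs"
  unfolding minor_def
proof (intro exI allI)
  let ?M = "mat (length rs) (length cs) (\<lambda>(a, b). [:G (rs ! a) (cs ! b), H (rs ! a) (cs ! b):])"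
  fix t :: 'a
  interpret comm_ring_hom "\<lambda>p. poly p t" by unfold_locales auto
  have "poly (det ?M) t = det (map_mat (\<lambda>p. poly p t) ?M)" by simp
  also have "map_mat (\<lambda>p. poly p t) ?M = mat (length rs) (length cs)
      (\<lambda>(a, b). G (rs ! a) (cs ! b) + t * H (rs ! a) (cs ! b))"
    by (rule eq_matI) auto
  finally show "poly (det ?M) t = det (mat (length rs) (length cs)
      (\<lambda>(a, b). G (rs ! a) (cs ! b) + t * H (rs ! a) (cs ! b)))" .
qed

text \<open>The minors restrict to polynomials on lines, so on the line through a point where all earlier
  minors are nonzero and one where the new minor is nonzero only finitely many points are bad.\<close>

lemma ex_common_nonzero_minors:
  fixes S :: "('r \<times> 'c) set"
  assumes inf: "infinite (UNIV :: 'a::field set)" and "finite F"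
    and "\<And>rs cs. (rs, cs) \<in> F \<Longrightarrow>
      \<exists>G :: 'r \<Rightarrow> 'c \<Rightarrow> 'a. (\<forall>i j. (i, j) \<notin> S \<longrightarrow> G i j = 0) \<and> minor G rs cs \<noteq> 0"
  shows "\<exists>G :: 'r \<Rightarrow> 'c \<Rightarrow> 'a. (\<forall>i j. (i, j) \<notin> S \<longrightarrow> G i j = 0) \<and>
    (\<forall>(rs, cs)\<in>F. minor G rs cs \<noteq> 0)"
  using assms(2,3)
proof (induction F)
  case empty
  then show ?case by (intro exI[of _ "\<lambda>_ _. 0"]) auto
next
  case (insert x F)
  obtain rs0 cs0 where x: "x = (rs0, cs0)" by (cases x)
  obtain G :: "'r \<Rightarrow> 'c \<Rightarrow> 'a" where G: "\<forall>i j. (i, j) \<notin> S \<longrightarrow> G i j = 0"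
      "\<forall>(rs, cs)\<in>F. minor G rs cs \<noteq> 0"
    using insert.IH insert.prems by blast
  obtain G' :: "'r \<Rightarrow> 'c \<Rightarrow> 'a" where G': "\<forall>i j. (i, j) \<notin> S \<longrightarrow> G' i j = 0" "minor G' rs0 cs0 \<noteq> 0"
    using insert.prems[of rs0 cs0] x by auto
  define L where "L t = (\<lambda>i j. G i j + t * (G' i j - G i j))" for t
  have L: "L 0 = G" "L 1 = G'" by (auto simp: L_def fun_eq_iff)
  have "finite {t. minor (L t) rs cs = 0}" if "minor (L s) rs cs \<noteq> 0" for s rs cs
  proof -
    obtain p where p: "\<And>t. poly p t = minor (L t) rs cs"
      using ex_poly_minor_line[of G "\<lambda>i j. G' i j - G i j" rs cs] unfolding L_def by blast
    then have "p \<noteq> 0" using that by (metis poly_0)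
    from poly_roots_finite[OF this] show ?thesis by (simp add: p)
  qed
  then have "finite {t. minor (L t) rs cs = 0}" if "(rs, cs) \<in> insert x F" for rs cs
    using that G(2) G'(2) L x by fastforce
  then have "finite (\<Union>(rs, cs)\<in>insert x F. {t. minor (L t) rs cs = 0})"
    using insert.hyps(1) by (intro finite_UN_I) (auto split: prod.split)
  from ex_new_if_finite[OF inf this]
  obtain t where "t \<notin> (\<Union>(rs, cs)\<in>insert x F. {t. minor (L t) rs cs = 0})" by blast
  then show ?case using G(1) G'(1) by (intro exI[of _ "L t"]) (auto simp: L_def)
qed

text \<open>Over a finite field the product of all \<open>x - a\<close>, plus 1, is a nonconstant
  polynomial whose values are all 1, hence without a root.\<close>

lemma infinite_alg_closed: "infinite (UNIV :: 'a::alg_closed_field set)"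
proof
  assume fin: "finite (UNIV :: 'a set)"
  define p :: "'a poly" where "p = (\<Prod>a\<in>UNIV. [:- a, 1:]) + 1"
  have "degree (\<Prod>a\<in>UNIV. [:- a, 1:] :: 'a poly) = card (UNIV :: 'a set)"
    by (simp add: degree_prod_sum_eq)
  moreover have "card (UNIV :: 'a set) > 0" using fin by (simp add: card_gt_0_iff)
  ultimately have "degree p > 0" unfolding p_def by (subst degree_add_eq_left) auto
  then obtain x where "poly p x = 0" using alg_closed_imp_poly_has_root by blast
  moreover have "(\<Prod>a\<in>UNIV. x - a) = 0" using fin by (simp add: prod_zero_iff)
  ultimately show False unfolding p_def by (simp add: poly_prod)
qed


section \<open>Row spaces and linear matroids\<close>

lemma row_space_iff:
  fixes A :: "nat \<Rightarrow> 'e \<Rightarrow> 'a::field"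
  shows "v \<in> row_space r A \<longleftrightarrow> (\<exists>c. \<forall>j. v j = (\<Sum>i\<in>{1..r}. c i * A i j))"
proof
  let ?S = "{v. \<exists>c. \<forall>j. v j = (\<Sum>i\<in>{1..r}. c i * A i j)}"
  have "fs.subspace ?S"
  proof (rule fs.subspaceI)
    show "0 \<in> ?S" by (auto intro!: exI[of _ "\<lambda>_. 0"])
    fix x y assume "x \<in> ?S" "y \<in> ?S"
    then obtain c c' where "\<forall>j. x j = (\<Sum>i\<in>{1..r}. c i * A i j)"
      "\<forall>j. y j = (\<Sum>i\<in>{1..r}. c' i * A i j)" by blast
    then show "x + y \<in> ?S"
      by (auto intro!: exI[of _ "\<lambda>i. c i + c' i"] simp: algebra_simps sum.distrib)
  next
    fix a x assume "x \<in> ?S"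
    then obtain c where "\<forall>j. x j = (\<Sum>i\<in>{1..r}. c i * A i j)" by blast
    then show "fscale a x \<in> ?S"
      by (auto intro!: exI[of _ "\<lambda>i. a * c i"] simp: fscale_def sum_distrib_left mult.assoc)
  qed
  moreover have "A ` {1..r} \<subseteq> ?S"
  proof
    fix x assume "x \<in> A ` {1..r}"
    then obtain i where i: "i \<in> {1..r}" "x = A i" by blast
    have "x j = (\<Sum>i'\<in>{1..r}. (if i' = i then 1 else 0) * A i' j)" for j
      using i sum.delta[of "{1..r}" i "\<lambda>i'. A i' j"] by (simp add: if_distrib[of "\<lambda>x. x * _"] cong: if_cong)
    then show "x \<in> ?S" by (intro CollectI exI allI)
  qed
  ultimately have "row_space r A \<subseteq> ?S" unfolding row_space_def by (intro fs.span_minimal)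
  then show "v \<in> row_space r A \<Longrightarrow> \<exists>c. \<forall>j. v j = (\<Sum>i\<in>{1..r}. c i * A i j)" by blast
next
  assume "\<exists>c. \<forall>j. v j = (\<Sum>i\<in>{1..r}. c i * A i j)"
  then obtain c where "\<forall>j. v j = (\<Sum>i\<in>{1..r}. c i * A i j)" by blast
  then have "v = (\<Sum>i\<in>{1..r}. fscale (c i) (A i))" by (simp add: fun_eq_iff fs_sum_apply fscale_def)
  then show "v \<in> row_space r A"
    unfolding row_space_def by (rule ssubst) (intro fs.span_sum fs.span_scale fs.span_base imageI)
qed

text \<open>The coefficients belong to row numbers, not to row vectors, so two equal rows count as
  dependent.\<close>

definition independent_rows :: "nat \<Rightarrow> (nat \<Rightarrow> 'e \<Rightarrow> 'a::field) \<Rightarrow> bool"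
  where "independent_rows r A \<longleftrightarrow>
    (\<forall>k. (\<forall>j. (\<Sum>i\<in>{1..r}. k i * A i j) = 0) \<longrightarrow> (\<forall>i\<in>{1..r}. k i = 0))"

text \<open>In a nontrivial relation a row with nonzero coefficient lies in the span of the others,
  so fewer than \<open>r\<close> vectors span. Conversely, each row of an independent family lies
  outside the span of the earlier ones; by induction the rows are distinct and form a basis.\<close>

lemma dim_row_space_iff:
  fixes A :: "nat \<Rightarrow> 'e \<Rightarrow> 'a::field"
  shows "fs.dim (row_space r A) = r \<longleftrightarrow> independent_rows r A"
proof
  assume dim: "fs.dim (row_space r A) = r"
  show "independent_rows r A"
    unfolding independent_rows_def
  proof (intro allI impI ballI, rule ccontr)
    fix k l assume k: "\<forall>j. (\<Sum>i\<in>{1..r}. k i * A i j) = 0" and l: "l \<in> {1..r}" "k l \<noteq> 0"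
    let ?B = "A ` ({1..r} - {l})"
    have "A l j = (\<Sum>i\<in>{1..r} - {l}. (- k i / k l) * A i j)" for j
    proof -
      have "k l * A l j + (\<Sum>i\<in>{1..r} - {l}. k i * A i j) = 0"
        using k l(1) sum.remove[of "{1..r}" l "\<lambda>i. k i * A i j"] by simp
      then have "A l j = - (\<Sum>i\<in>{1..r} - {l}. k i * A i j) / k l"
        using l(2) by (simp add: field_simps eq_neg_iff_add_eq_0)
      then show ?thesis by (simp add: sum_divide_distrib sum_negf)
    qed
    then have "A l = (\<Sum>i\<in>{1..r} - {l}. fscale (- k i / k l) (A i))"
      by (simp add: fun_eq_iff fs_sum_apply fscale_def)
    then have "A l \<in> fs.span ?B"
      by (rule ssubst) (intro fs.span_sum fs.span_scale fs.span_base imageI)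
    then have "A i \<in> fs.span ?B" if "i \<in> {1..r}" for i
      using that by (cases "i = l") (auto intro: fs.span_base)
    then have "A ` {1..r} \<subseteq> fs.span ?B" by blast
    then have "row_space r A \<subseteq> fs.span ?B" by (simp add: row_space_def fs.span_minimal)
    then have "r \<le> card ?B" using fs.dim_le_card[of "row_space r A" ?B] dim by simp
    also have "\<dots> \<le> card ({1..r} - {l})" by (rule card_image_le) simp
    also have "\<dots> < r" using l(1) by simp
    finally show False by simp
  qed
next
  have "fs.independent (A ` {1..r}) \<and> card (A ` {1..r}) = r" if "independent_rows r A" for r
    using that
  proof (induction r)
    case (Suc r)
    have "independent_rows r A"
      unfolding independent_rows_def
    proof (intro allI impI ballI)
      fix k i assume k: "\<forall>j. (\<Sum>i\<in>{1..r}. k i * A i j) = 0" and i: "i \<in> {1..r}"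
      then have "\<forall>j. (\<Sum>i\<in>{1..Suc r}. (k(Suc r := 0)) i * A i j) = 0" by simp
      from Suc.prems[unfolded independent_rows_def, rule_format, OF this[rule_format], of i]
      show "k i = 0" using i by simp
    qed
    note IH = Suc.IH[OF this]
    have ins: "A ` {1..Suc r} = insert (A (Suc r)) (A ` {1..r})"
      by (auto simp: atLeastAtMostSuc_conv)
    have "A (Suc r) \<notin> row_space r A"
    proof
      assume "A (Suc r) \<in> row_space r A"
      then obtain c where "\<forall>j. A (Suc r) j = (\<Sum>i\<in>{1..r}. c i * A i j)" unfolding row_space_iff by blast
      then have "\<forall>j. (\<Sum>i\<in>{1..Suc r}. (c(Suc r := - 1)) i * A i j) = 0" by simp
      from Suc.prems[unfolded independent_rows_def, rule_format, OF this[rule_format], of "Suc r"]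
      show False by simp
    qed
    then have notin: "A (Suc r) \<notin> fs.span (A ` {1..r})" by (simp add: row_space_def)
    then have "A (Suc r) \<notin> A ` {1..r}" using fs.span_base by blast
    with IH notin show ?case unfolding ins by (simp add: fs.independent_insert)
  qed (simp add: fs.independent_empty)
  moreover assume "independent_rows r A"
  ultimately show "fs.dim (row_space r A) = r"
    by (metis fs.dim_eq_card_independent fs.dim_span row_space_def)
qed

lemma row_space_in_Gr:
  assumes "is_matrix r {1..n} A" "independent_rows r A"
  shows "row_space r A \<in> Gr r n"
proof -
  have "fs.subspace (coord_space {1..n} :: (nat \<Rightarrow> 'a) set)"
    by (rule fs.subspaceI) (auto simp: coord_space_def fscale_def)
  then have "row_space r A \<subseteq> coord_space {1..n}"
    unfolding row_space_def using assms(1) by (intro fs.span_minimal) (auto simp: is_matrix_def)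
  then show ?thesis using assms(2) dim_row_space_iff[of r A] by (simp add: Gr_def row_space_def)
qed

lemma Gr_ex_matrix:
  fixes X :: "(nat \<Rightarrow> 'a::field) set"
  assumes "X \<in> Gr m n" "m > 0"
  shows "\<exists>W. is_matrix m {1..n} W \<and> row_space m W = X"
proof -
  have X: "fs.subspace X" "X \<subseteq> coord_space {1..n}" "fs.dim X = m" using assms(1) by (auto simp: Gr_def)
  obtain B where B: "B \<subseteq> X" "X \<subseteq> fs.span B" "card B = m"
    using fs.basis_exists[of X] X(3) by metis
  \<comment> \<open>\<open>card\<close> is 0 on infinite sets, so \<open>m > 0\<close> makes the
    basis finite.\<close>
  then have "finite B" using assms(2) card_ge_0_finite by blast
  then obtain W where "bij_betw W {1..m} B" using ex_bij_betw_nat_finite_1 B(3) by metis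
  then have W: "W ` {1..m} = B" by (simp add: bij_betw_def)
  have "fs.span B = X" using B(1,2) X(1) fs.span_minimal by blast
  then have "row_space m W = X" by (simp only: row_space_def W)
  moreover have "is_matrix m {1..n} W" using W B(1) X(2) by (auto simp: is_matrix_def)
  ultimately show ?thesis by blast
qed

lemma independent_rows_if_minor:
  fixes G :: "nat \<Rightarrow> 'e \<Rightarrow> 'a::field"
  assumes "minor G [1..<d+2] cs \<noteq> 0" "length cs = d + 1"
  shows "independent_rows (d+1) G"
proof -
  have "set [1..<d+2] = {1..d+1}" by auto
  then show ?thesis
    using assms minor_nonzero_iff_rows[of "[1..<d+2]" cs G] by (auto simp: independent_rows_def)
qed

section \<open>Column independence and extension of independent sets\<close>

text \<open>The family independence of \<open>linear_matroid\<close>, with coefficients indexed by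
  elements of the ground set; \<open>indep_linear_matroid_iff\<close> is the translation.\<close>

definition independent_columns :: "nat \<Rightarrow> (nat \<Rightarrow> 'e \<Rightarrow> 'a::field) \<Rightarrow> 'e set \<Rightarrow> bool"
  where "independent_columns r A J \<longleftrightarrow>
    (\<forall>k. (\<forall>i\<in>{1..r}. (\<Sum>j\<in>J. k j * A i j) = 0) \<longrightarrow> (\<forall>j\<in>J. k j = 0))"

lemma independent_columns_mono:
  assumes "independent_columns r A J" "finite J" "I \<subseteq> J"
  shows "independent_columns r A I"
  unfolding independent_columns_def
proof (intro allI impI ballI)
  fix k j assume k: "\<forall>i\<in>{1..r}. (\<Sum>j\<in>I. k j * A i j) = 0" and j: "j \<in> I"
  define k' where "k' j = (if j \<in> I then k j else 0)" for j
  have "(\<Sum>j\<in>J. k' j * A i j) = (\<Sum>j\<in>I. k j * A i j)" for i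
    using assms(2,3) by (intro sum.mono_neutral_cong_right) (auto simp: k'_def)
  then have "\<forall>j\<in>J. k' j = 0" using k assms(1) unfolding independent_columns_def by simp
  then have "k' j = 0" using j assms(3) by blast
  then show "k j = 0" using j by (simp add: k'_def)
qed

text \<open>A linear relation that holds for all rows holds on their span, so the test on the whole
  row space in \<open>column_family_independent_iff\<close> reduces to the rows.\<close>

lemma indep_linear_matroid_iff:
  fixes A :: "nat \<Rightarrow> 'e \<Rightarrow> 'a::field"
  assumes "finite E" "is_matrix r E A"
  shows "J \<in> indep (linear_matroid E (row_space r A)) \<longleftrightarrow> J \<subseteq> E \<and> independent_columns r A J"
proof (cases "J \<subseteq> E")
  case True
  have "(\<forall>v\<in>row_space r A. (\<Sum>j\<in>J. k j * v j) = 0) \<longleftrightarrow> (\<forall>i\<in>{1..r}. (\<Sum>j\<in>J. k j * A i j) = 0)"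
    for k :: "'e \<Rightarrow> 'a"
  proof
    assume h: "\<forall>i\<in>{1..r}. (\<Sum>j\<in>J. k j * A i j) = 0"
    have "fs.subspace {v. (\<Sum>j\<in>J. k j * v j) = 0}"
      by (rule fs.subspaceI)
        (auto simp: fscale_def algebra_simps sum.distrib simp flip: sum_distrib_left)
    then have "row_space r A \<subseteq> {v. (\<Sum>j\<in>J. k j * v j) = 0}"
      unfolding row_space_def using h by (intro fs.span_minimal) auto
    then show "\<forall>v\<in>row_space r A. (\<Sum>j\<in>J. k j * v j) = 0" by blast
  qed (auto simp: row_space_def intro: fs.span_base)
  then show ?thesis
    using indep_linear_matroid_row_space[OF assms, of J] True
      column_family_independent_iff[OF finite_subset[OF True assms(1)], of r A]
    by (simp add: independent_columns_def)
qed (simp add: linear_matroid_def)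

text \<open>The exchange axiom adds elements of \<open>I'\<close> to \<open>I\<close> one at a time
  until the cardinalities agree.\<close>

lemma is_matroid_extend_indep:
  assumes M: "is_matroid M" and I: "I \<in> indep M" "I' \<in> indep M" "card I \<le> card I'"
  shows "\<exists>K\<in>indep M. I \<subseteq> K \<and> card K = card I'"
  using I
proof (induction "card I' - card I" arbitrary: I)
  case (Suc m)
  then have "card I < card I'" by simp
  moreover have "\<forall>I\<in>indep M. \<forall>I'\<in>indep M. card I < card I' \<longrightarrow> (\<exists>x\<in>I' - I. insert x I \<in> indep M)"
    using M by (simp add: is_matroid_def)
  ultimately obtain x where x: "x \<in> I' - I" "insert x I \<in> indep M"
    using Suc.prems(1,2) by blast
  have "finite (ground M)" "indep M \<subseteq> Pow (ground M)" using M by (simp_all add: is_matroid_def)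
  then have "finite I" using Suc.prems(1) by (meson PowD finite_subset subsetD)
  then have "card (insert x I) = Suc (card I)" using x(1) by simp
  then have "\<exists>K\<in>indep M. insert x I \<subseteq> K \<and> card K = card I'"
    using Suc.hyps(2) x(2) Suc.prems(2) \<open>card I < card I'\<close> by (intro Suc.hyps(1)) auto
  then show ?case by blast
qed auto


section \<open>The linear space L(X)\<close>

text \<open>The column J of the matrix V is the linear form sending c to the determinant of the matrix with
  first column c followed by the columns J of W (Laplace expansion). The column c is adjoined to W
  under the index None.\<close>

definition adjoin :: "('r \<Rightarrow> 'a) \<Rightarrow> ('r \<Rightarrow> 'c \<Rightarrow> 'a) \<Rightarrow> 'r \<Rightarrow> 'c option \<Rightarrow> 'a"
  where "adjoin c W i j = (case j of None \<Rightarrow> c i | Some j \<Rightarrow> W i j)"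

lemma minor_adjoin_column:
  "minor (adjoin (\<lambda>i. W i x) W) rs (None # map Some js) = minor W rs (x # js)"
proof -
  have "mat (length rs) (Suc (length js)) (\<lambda>(a, b). adjoin (\<lambda>i. W i x) W (rs ! a) ((None # map Some js) ! b)) =
      mat (length rs) (Suc (length js)) (\<lambda>(a, b). W (rs ! a) ((x # js) ! b))"
    by (rule eq_matI) (auto simp: adjoin_def nth_Cons split: nat.split)
  then show ?thesis by (simp add: minor_def)
qed

text \<open>Links the row list used in \<open>V_matrix\<close>, numbered from 1, with the deletion
  of row \<open>i\<close>, counted from 0, in a cofactor.\<close>

lemma sorted_list_of_set_remove_nth:
  assumes "i < d + 1"
  shows "sorted_list_of_set ({1..d+1} - {i+1}) = [1..<i+1] @ [i+2..<d+2]"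
proof -
  have "{1..d+1} - {i+1} = set ([1..<i+1] @ [i+2..<d+2])" using assms by auto
  moreover have "sorted ([1..<i+1] @ [i+2..<d+2])" "distinct ([1..<i+1] @ [i+2..<d+2])"
    by (auto simp: sorted_append)
  ultimately show ?thesis by (metis sorted_list_of_set.idem_if_sorted_distinct)
qed

lemma sum_V_matrix:
  fixes W :: "nat \<Rightarrow> nat \<Rightarrow> 'a::field"
  assumes "J \<in> nsets {1..n} d"
  shows "(\<Sum>i\<in>{1..d+1}. c i * V_matrix d n W i J) =
    minor (adjoin c W) [1..<d+2] (None # map Some (sorted_list_of_set J))"
proof -
  define js where "js = sorted_list_of_set J"
  have js: "length js = d" using assms by (auto simp: js_def nsets_def)
  define M where "M = mat (d+1) (d+1) (\<lambda>(a, b). adjoin c W ([1..<d+2] ! a) ((None # map Some js) ! b))"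
  have M: "M \<in> carrier_mat (d+1) (d+1)" by (simp add: M_def)
  have "minor (adjoin c W) [1..<d+2] (None # map Some js) = det M"
    using js by (simp add: minor_def M_def del: upt_Suc)
  also have "\<dots> = (\<Sum>i<d+1. M $$ (i, 0) * cofactor M i 0)"
    using laplace_expansion_column[OF M, of 0] by simp
  also have "\<dots> = (\<Sum>i<d+1. c (i+1) * V_matrix d n W (i+1) J)"
  proof (rule sum.cong)
    fix i assume "i \<in> {..<d+1}"
    then have i: "i < d + 1" by simp
    have "mat_delete M i 0 = mat d d (\<lambda>(a, b). W (([1..<i+1] @ [i+2..<d+2]) ! a) (js ! b))"
      using i js by (intro eq_matI) (auto simp: mat_delete_def M_def adjoin_def nth_append simp del: upt_Suc)
    \<comment> \<open>The signs agree: the cofactor of row \<open>i\<close>, counted from 0, has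
      \<open>(-1) ^ (i + 0)\<close>, and V has \<open>(-1) ^ (i + 2)\<close> in its row
      \<open>i + 1\<close>.\<close>
    then have "cofactor M i 0 = V_matrix d n W (i+1) J"
      using assms i js
      unfolding cofactor_def V_matrix_def minor_def sorted_list_of_set_remove_nth[OF i]
      by (simp add: js_def del: upt_Suc)
    moreover have "M $$ (i, 0) = c (i+1)" using i by (simp add: M_def adjoin_def del: upt_Suc)
    ultimately show "M $$ (i, 0) * cofactor M i 0 = c (i+1) * V_matrix d n W (i+1) J" by simp
  qed simp
  also have "\<dots> = (\<Sum>i\<in>{1..d+1}. c i * V_matrix d n W i J)"
    by (rule sum.reindex_bij_witness[of _ "\<lambda>i. i - 1" Suc]) auto
  finally show ?thesis by (simp add: js_def)
qed

lemma sum_column_V_matrix: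
  fixes W :: "nat \<Rightarrow> nat \<Rightarrow> 'a::field"
  assumes "J \<in> nsets {1..n} d"
  shows "(\<Sum>i\<in>{1..d+1}. W i y * V_matrix d n W i J) = minor W [1..<d+2] (y # sorted_list_of_set J)"
  using sum_V_matrix[OF assms, of "\<lambda>i. W i y" W] minor_adjoin_column[of W y] by simp

text \<open>For \<open>y\<close> in \<open>J\<close> the determinant has two equal columns, indexed
  by \<open>None\<close> and \<open>Some y\<close>. This is the vanishing from which both directions
  of the theorem draw.\<close>

lemma sum_column_V_matrix_eq_0:
  fixes W :: "nat \<Rightarrow> nat \<Rightarrow> 'a::field"
  assumes J: "J \<in> nsets {1..n} d" and y: "y \<in> J"
  shows "(\<Sum>i\<in>{1..d+1}. W i y * V_matrix d n W i J) = 0"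
proof -
  have J': "finite J" "card J = d" using J by (auto simp: nsets_def)
  define cs where "cs = None # map Some (sorted_list_of_set J)"
  define k :: "nat option \<Rightarrow> 'a" where
    "k = (\<lambda>z. if z = None then 1 else if z = Some y then - 1 else 0)"
  have "(\<Sum>z\<in>set cs. k z * adjoin (\<lambda>i. W i y) W r z) =
      (\<Sum>z\<in>{None, Some y}. k z * adjoin (\<lambda>i. W i y) W r z)" for r
    by (rule sum.mono_neutral_right) (use y J' in \<open>auto simp: cs_def k_def\<close>)
  then have "\<forall>r\<in>set [1..<d+2]. (\<Sum>z\<in>set cs. k z * adjoin (\<lambda>i. W i y) W r z) = 0"
    by (simp add: k_def adjoin_def)
  moreover have "k None \<noteq> 0" "None \<in> set cs" by (auto simp: k_def cs_def)
  moreover have "distinct cs" "length cs = length [1..<d+2]"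
    using J' by (auto simp: cs_def distinct_map)
  ultimately have "minor (adjoin (\<lambda>i. W i y) W) [1..<d+2] cs = 0"
    using minor_nonzero_iff by blast
  then show ?thesis unfolding cs_def using sum_V_matrix[OF J, of "\<lambda>i. W i y" W] by simp
qed

lemma V_matrix_is_matrix: "is_matrix r (nsets {1..n} d) (V_matrix d n W)"
  by (auto simp: is_matrix_def coord_space_def V_matrix_def)

text \<open>Both sides are the determinant of the product of P and the matrix of \<open>adjoin c W\<close>: the
  assumptions on c say that the first column of this product is the first unit vector.\<close>

lemma minor_mult_sum_V_matrix:
  fixes W :: "nat \<Rightarrow> nat \<Rightarrow> 'a::field"
  assumes J: "J \<in> nsets {1..n} d"
    and c1: "(\<Sum>k\<in>{1..d+1}. P 1 k * c k) = 1"
    and c2: "\<And>i. i \<in> {1..d} \<Longrightarrow> (\<Sum>k\<in>{1..d+1}. P (Suc i) k * c k) = 0"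
    and A: "\<And>i j. i \<in> {1..d} \<Longrightarrow> A i j = (\<Sum>k\<in>{1..d+1}. P (Suc i) k * W k j)"
  shows "minor P [1..<d+2] [1..<d+2] * (\<Sum>i\<in>{1..d+1}. c i * V_matrix d n W i J) =
    minor A [1..<d+1] (sorted_list_of_set J)"
proof -
  define js where "js = sorted_list_of_set J"
  have js: "length js = d" using J by (auto simp: js_def nsets_def)
  define M where "M = mat (d+1) (d+1) (\<lambda>(a, b). adjoin c W ([1..<d+2] ! a) ((None # map Some js) ! b))"
  define Q where "Q = mat (d+1) (d+1) (\<lambda>(a, b). P ([1..<d+2] ! a) ([1..<d+2] ! b))"
  have M: "M \<in> carrier_mat (d+1) (d+1)" and Q: "Q \<in> carrier_mat (d+1) (d+1)"
    by (simp_all add: M_def Q_def)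
  define N where "N = Q * M"
  have N: "N \<in> carrier_mat (d+1) (d+1)" using M Q by (simp add: N_def)
  have entry: "N $$ (a, b) = (\<Sum>k\<in>{1..d+1}. P (a+1) k * adjoin c W k ((None # map Some js) ! b))"
    if "a < d+1" "b < d+1" for a b
  proof -
    have "N $$ (a, b) = (\<Sum>k\<in>{0..<d+1}. P (a+1) (k+1) * adjoin c W (k+1) ((None # map Some js) ! b))"
      unfolding N_def using that M Q
      by (auto simp: scalar_prod_def M_def Q_def simp del: upt_Suc intro!: sum.cong)
    also have "\<dots> = (\<Sum>k\<in>{1..d+1}. P (a+1) k * adjoin c W k ((None # map Some js) ! b))"
      by (rule sum.reindex_bij_witness[of _ "\<lambda>i. i - 1" Suc]) auto
    finally show ?thesis .
  qed
  have "det N = (\<Sum>i<d+1. N $$ (i, 0) * cofactor N i 0)"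
    using laplace_expansion_column[OF N, of 0] by simp
  also have "\<dots> = (\<Sum>i\<in>{0}. N $$ (i, 0) * cofactor N i 0)"
  proof (rule sum.mono_neutral_right)
    show "\<forall>i\<in>{..<d+1} - {0}. N $$ (i, 0) * cofactor N i 0 = 0"
      using entry[of _ 0] c2 by (auto simp: adjoin_def)
  qed auto
  also have "\<dots> = cofactor N 0 0" using entry[of 0 0] c1 by (simp add: adjoin_def)
  also have "mat_delete N 0 0 = mat d d (\<lambda>(a, b). A ([1..<d+1] ! a) (js ! b))"
    using N js
    by (intro eq_matI) (auto simp: mat_delete_def entry adjoin_def A simp del: upt_Suc sum.cl_ivl_Suc)
  then have "cofactor N 0 0 = minor A [1..<d+1] js"
    by (simp add: cofactor_def minor_def js del: upt_Suc)
  finally have "det N = minor A [1..<d+1] js" .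
  moreover have "det N = det Q * det M" unfolding N_def by (rule det_mult[OF Q M])
  moreover have "det M = (\<Sum>i\<in>{1..d+1}. c i * V_matrix d n W i J)"
    unfolding sum_V_matrix[OF J] minor_def M_def using js by (simp add: js_def del: upt_Suc)
  moreover have "det Q = minor P [1..<d+2] [1..<d+2]" by (simp add: minor_def Q_def del: upt_Suc)
  ultimately show ?thesis by (simp add: js_def)
qed

section \<open>Pluecker vectors and the row space of V\<close>

text \<open>Let \<open>B\<close> hold the coefficients of the rows of \<open>A\<close> with respect
  to those of \<open>W\<close>. Its \<open>d\<close> rows annihilate some nonzero \<open>c\<close>
  with \<open>d + 1\<close> entries. Putting a row with value 1 at \<open>c\<close> on top of
  \<open>B\<close> gives a matrix \<open>P\<close> to which \<open>minor_mult_sum_V_matrix\<close>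
  applies. \<open>P\<close> may be singular; the Pluecker vector is then 0.\<close>

lemma plucker_vector_mem:
  fixes W :: "nat \<Rightarrow> nat \<Rightarrow> 'a::field"
  assumes "row_space d A \<subseteq> row_space (d+1) W"
  shows "plucker_vector d n A \<in> row_space (d+1) (V_matrix d n W)"
proof -
  have "\<exists>c. \<forall>j. A i j = (\<Sum>k\<in>{1..d+1}. c k * W k j)" if "i \<in> {1..d}" for i
  proof -
    have "A i \<in> row_space (d+1) W" using that assms unfolding row_space_def by (meson fs.span_base imageI subsetD)
    then show ?thesis unfolding row_space_iff .
  qed
  then obtain B where B: "\<And>i j. i \<in> {1..d} \<Longrightarrow> A i j = (\<Sum>k\<in>{1..d+1}. B i k * W k j)" by metis
  have "\<exists>c. (\<exists>k\<in>{1..d+1}. c k \<noteq> 0) \<and> (\<forall>i\<in>{1..d}. (\<Sum>k\<in>{1..d+1}. c k * B i k) = 0)"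
    by (rule ex_nontrivial_solution) auto
  then obtain c l where c: "\<forall>i\<in>{1..d}. (\<Sum>k\<in>{1..d+1}. c k * B i k) = 0"
    and l: "l \<in> {1..d+1}" "c l \<noteq> 0" by blast
  define P where "P i k = (if i = 1 then (if k = l then 1 / c l else 0) else B (i - 1) k)" for i k
  have "(\<Sum>k\<in>{1..d+1}. P 1 k * c k) = (\<Sum>k\<in>{1..d+1}. if k = l then 1 else 0)"
    by (rule sum.cong) (use l in \<open>auto simp: P_def\<close>)
  then have P1: "(\<Sum>k\<in>{1..d+1}. P 1 k * c k) = 1" using l(1) by (simp del: sum.cl_ivl_Suc)
  have "plucker_vector d n A J =
    (\<Sum>i\<in>{1..d+1}. (minor P [1..<d+2] [1..<d+2] * c i) * V_matrix d n W i J)" for J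
  proof (cases "J \<in> nsets {1..n} d")
    case True
    have "minor P [1..<d+2] [1..<d+2] * (\<Sum>i\<in>{1..d+1}. c i * V_matrix d n W i J) =
        minor A [1..<d+1] (sorted_list_of_set J)"
    proof (rule minor_mult_sum_V_matrix[where P = P and c = c and W = W, OF True P1])
      fix i assume "i \<in> {1..d}"
      then show "(\<Sum>k\<in>{1..d+1}. P (Suc i) k * c k) = 0"
        "A i j = (\<Sum>k\<in>{1..d+1}. P (Suc i) k * W k j)" for j
        using c B by (simp_all add: P_def mult.commute del: sum.cl_ivl_Suc)
    qed
    then show ?thesis using True
      by (simp add: plucker_vector_def sum_distrib_left mult.assoc del: sum.cl_ivl_Suc upt_Suc)
  next
    case False
    then show ?thesis by (simp add: plucker_vector_def V_matrix_def)
  qed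
  then show ?thesis unfolding row_space_iff by (intro exI allI)
qed

text \<open>The coefficient vectors annihilating \<open>c\<close> form a hyperplane. The rows of
  \<open>A\<close> are the combinations of rows of \<open>W\<close> given by a basis of this
  hyperplane, and \<open>P\<close>, that basis below a row with value 1 at \<open>c\<close>, is
  invertible. Hence every combination of rows of V is a multiple of the Pluecker vector of an actual
  subspace.\<close>

lemma ex_plucker_vector:
  fixes W :: "nat \<Rightarrow> nat \<Rightarrow> 'a::field"
  assumes W: "is_matrix (d+1) {1..n} W" "independent_rows (d+1) W"
    and l: "l \<in> {1..d+1}" "c l \<noteq> 0"
  shows "\<exists>A a. is_matrix d {1..n} A \<and> row_space d A \<subseteq> row_space (d+1) W \<and> independent_rows d A \<and>
    (\<forall>J. (\<Sum>i\<in>{1..d+1}. c i * V_matrix d n W i J) = a * plucker_vector d n A J)"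
proof -
  \<comment> \<open>A transposition, so that \<tau> maps \<open>2, ..., d + 1\<close> onto the row
    numbers other than \<open>l\<close>.\<close>
  define \<tau> where "\<tau> = Transposition.transpose 1 l"
  have \<tau>: "bij_betw \<tau> {1..d+1} {1..d+1}"
    using l(1) unfolding \<tau>_def by (intro permutes_imp_bij permutes_swap_id) auto
  have \<tau>1: "\<tau> 1 = l" by (simp add: \<tau>_def)
  have \<tau>in: "\<tau> k \<in> {1..d+1}" if "k \<in> {1..d+1}" for k using \<tau> that by (auto dest: bij_betwE)
  have \<tau>neq: "\<tau> (Suc i) \<noteq> l" if "i \<in> {1..d}" for i
    using that \<tau> \<tau>1 l(1) inj_onD[OF bij_betw_imp_inj_on[OF \<tau>], of "Suc i" 1] by auto
  \<comment> \<open>The first row has value 1 at \<open>c\<close>. Each other row is the unit vector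
    at \<open>\<tau> i\<close>, corrected in position \<open>l\<close> so as to annihilate
    \<open>c\<close>.\<close>
  define P where "P i k = (if i = 1 then (if k = l then 1 / c l else 0)
    else (if k = \<tau> i then 1 else 0) - (if k = l then c (\<tau> i) / c l else 0))" for i k
  define A where "A i j = W (\<tau> (Suc i)) j - c (\<tau> (Suc i)) / c l * W l j" for i j
  have sum_l: "(\<Sum>k\<in>{1..d+1}. (if k = m then x else 0) * f k) = x * f m" if "m \<in> {1..d+1}"
    for x m and f :: "nat \<Rightarrow> 'a"
    using that by (simp add: if_distrib[of "\<lambda>x. x * _"] del: sum.cl_ivl_Suc cong: if_cong)
  have P1: "(\<Sum>k\<in>{1..d+1}. P 1 k * f k) = f l / c l" for f
    using sum_l[OF l(1), of "1 / c l" f] by (simp add: P_def del: sum.cl_ivl_Suc)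
  have P2: "(\<Sum>k\<in>{1..d+1}. P (Suc i) k * f k) = f (\<tau> (Suc i)) - c (\<tau> (Suc i)) / c l * f l"
    if "i \<in> {1..d}" for i f
  proof -
    have "(\<Sum>k\<in>{1..d+1}. P (Suc i) k * f k) =
      (\<Sum>k\<in>{1..d+1}. (if k = \<tau> (Suc i) then 1 else 0) * f k) -
      (\<Sum>k\<in>{1..d+1}. (if k = l then c (\<tau> (Suc i)) / c l else 0) * f k)"
      unfolding sum_subtractf[symmetric] using that
      by (intro sum.cong) (auto simp: P_def algebra_simps)
    also have "\<dots> = f (\<tau> (Suc i)) - c (\<tau> (Suc i)) / c l * f l"
      using sum_l[OF l(1)] sum_l[OF \<tau>in, of "Suc i"] that by simp
    finally show ?thesis .
  qed
  have "minor P [1..<d+2] [1..<d+2] \<noteq> 0"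
  proof (subst minor_nonzero_iff)
    show "\<forall>f. (\<forall>r\<in>set [1..<d+2]. (\<Sum>y\<in>set [1..<d+2]. f y * P r y) = 0) \<longrightarrow>
      (\<forall>y\<in>set [1..<d+2]. f y = 0)"
    proof (intro allI impI)
      fix f assume *: "\<forall>r\<in>set [1..<d+2]. (\<Sum>y\<in>set [1..<d+2]. f y * P r y) = 0"
      have set: "set [1..<d+2] = {1..d+1}" by auto
      have f: "(\<Sum>k\<in>{1..d+1}. P r k * f k) = 0" if "r \<in> {1..d+1}" for r
        using * that unfolding set by (metis (no_types, lifting) mult.commute sum.cong)
      have "f l = 0" using f[of 1] P1[of f] l(2) by simp
      moreover have "f (\<tau> (Suc i)) = 0" if "i \<in> {1..d}" for i
        using f[of "Suc i"] P2[OF that, of f] that \<open>f l = 0\<close> by simp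
      ultimately have "f (\<tau> i) = 0" if "i \<in> {1..d+1}" for i
        using that \<tau>1 by (cases i; cases "i = 1") auto
      then show "\<forall>y\<in>set [1..<d+2]. f y = 0"
        unfolding set using bij_betw_imp_surj_on[OF \<tau>] by (metis imageE)
    qed
  qed auto
  moreover have "minor P [1..<d+2] [1..<d+2] * (\<Sum>i\<in>{1..d+1}. c i * V_matrix d n W i J) =
      plucker_vector d n A J" for J
  proof (cases "J \<in> nsets {1..n} d")
    case True
    have "minor P [1..<d+2] [1..<d+2] * (\<Sum>i\<in>{1..d+1}. c i * V_matrix d n W i J) =
        minor A [1..<d+1] (sorted_list_of_set J)"
    proof (rule minor_mult_sum_V_matrix[where P = P and c = c and W = W, OF True])
      show "(\<Sum>k\<in>{1..d+1}. P 1 k * c k) = 1" using P1[of c] l(2) by simp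
      fix i assume i: "i \<in> {1..d}"
      show "(\<Sum>k\<in>{1..d+1}. P (Suc i) k * c k) = 0" using P2[OF i, of c] l(2) by simp
      show "A i j = (\<Sum>k\<in>{1..d+1}. P (Suc i) k * W k j)" for j
        using P2[OF i, of "\<lambda>k. W k j"] by (simp add: A_def)
    qed
    then show ?thesis using True by (simp add: plucker_vector_def)
  next
    case False
    then show ?thesis by (simp add: plucker_vector_def V_matrix_def)
  qed
  ultimately have "(\<Sum>i\<in>{1..d+1}. c i * V_matrix d n W i J) =
      1 / minor P [1..<d+2] [1..<d+2] * plucker_vector d n A J" for J
    by (metis (no_types, lifting) mult.commute nonzero_mult_div_cancel_left times_divide_eq_left mult_1)
  moreover have "is_matrix d {1..n} A"
    using W(1) l(1) \<tau>in by (auto simp: is_matrix_def coord_space_def A_def)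
  moreover have "row_space d A \<subseteq> row_space (d+1) W"
    unfolding row_space_def[of d]
  proof (rule fs.span_minimal)
    show "A ` {1..d} \<subseteq> row_space (d+1) W"
    proof
      fix x assume "x \<in> A ` {1..d}"
      then obtain i where i: "i \<in> {1..d}" "x = A i" by blast
      have "x j = (\<Sum>k\<in>{1..d+1}. P (Suc i) k * W k j)" for j
        using P2[OF i(1), of "\<lambda>k. W k j"] by (simp add: A_def i(2))
      then show "x \<in> row_space (d+1) W" unfolding row_space_iff by (intro exI allI)
    qed
  qed (simp add: row_space_def)
  moreover have "independent_rows d A"
    unfolding independent_rows_def
  proof (intro allI impI ballI)
    fix k i assume k: "\<forall>j. (\<Sum>i\<in>{1..d}. k i * A i j) = 0" and i: "i \<in> {1..d}"
    \<comment> \<open>The coefficient of row \<open>m\<close> of \<open>W\<close> in the given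
      relation. It vanishes as the rows of \<open>W\<close> are independent, and at
      \<open>\<tau> (Suc i)\<close> only row \<open>i\<close> of \<open>A\<close> contributes, so it
      equals \<open>k i\<close> there.\<close>
    define h where "h m = (\<Sum>i\<in>{1..d}. k i * P (Suc i) m)" for m
    have "(\<Sum>m\<in>{1..d+1}. h m * W m j) = 0" for j
    proof -
      have "(\<Sum>m\<in>{1..d+1}. h m * W m j) = (\<Sum>i\<in>{1..d}. \<Sum>m\<in>{1..d+1}. k i * (P (Suc i) m * W m j))"
        unfolding h_def sum_distrib_right by (subst sum.swap) (simp only: mult.assoc)
      also have "\<dots> = (\<Sum>i\<in>{1..d}. k i * A i j)"
        using P2[of _ "\<lambda>k. W k j"]
        by (intro sum.cong) (simp_all add: A_def sum_distrib_left[symmetric] del: sum.cl_ivl_Suc)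
      finally show ?thesis using k by simp
    qed
    then have "h (\<tau> (Suc i)) = 0"
      using W(2) \<tau>in[of "Suc i"] i unfolding independent_rows_def by auto
    moreover have "P (Suc i') (\<tau> (Suc i)) = (if i' = i then 1 else 0)" if "i' \<in> {1..d}" for i'
      using \<tau>neq[OF i] that i inj_onD[OF bij_betw_imp_inj_on[OF \<tau>], of "Suc i'" "Suc i"]
      by (auto simp: P_def)
    then have "h (\<tau> (Suc i)) = (\<Sum>i'\<in>{1..d}. k i' * (if i' = i then 1 else 0))"
      unfolding h_def by (intro sum.cong) auto
    then have "h (\<tau> (Suc i)) = k i"
      using i by (simp add: if_distrib[of "\<lambda>x. _ * x"] cong: if_cong)
    ultimately show "k i = 0" by simp
  qed
  ultimately show ?thesis by blast
qed

text \<open>The two preceding lemmas are the two inclusions. With this equality the matroid of L(X)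
  can be read off the columns of V.\<close>

lemma Union_L_space:
  fixes W :: "nat \<Rightarrow> nat \<Rightarrow> 'a::field"
  assumes W: "is_matrix (d+1) {1..n} W" "independent_rows (d+1) W"
  shows "\<Union> (L_space d n (row_space (d+1) W)) = row_space (d+1) (V_matrix d n W)"
proof (intro equalityI subsetI)
  fix v assume "v \<in> \<Union> (L_space d n (row_space (d+1) W))"
  then obtain A a where "row_space d A \<subseteq> row_space (d+1) W" "v = fscale a (plucker_vector d n A)"
    by (auto simp: L_space_def plucker_def)
  then show "v \<in> row_space (d+1) (V_matrix d n W)"
    using plucker_vector_mem[of d A W n] by (auto simp: row_space_def fs.span_scale)
next
  fix v assume "v \<in> row_space (d+1) (V_matrix d n W)"
  then obtain c where c: "\<forall>J. v J = (\<Sum>i\<in>{1..d+1}. c i * V_matrix d n W i J)"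
    unfolding row_space_iff by blast
  \<comment> \<open>For \<open>c\<close> zero on \<open>{1..d+1}\<close>, \<open>v\<close> is the
    zero vector, which lies on every line, but some line must still be exhibited; the constant 1
    then serves as the nonzero coefficient vector.\<close>
  define e where "e = (if \<exists>l\<in>{1..d+1}. c l \<noteq> 0 then c else (\<lambda>_. 1))"
  obtain l where "l \<in> {1..d+1}" "e l \<noteq> 0" unfolding e_def by (cases "\<exists>l\<in>{1..d+1}. c l \<noteq> 0") auto
  from ex_plucker_vector[where c = e, OF W this] obtain A a where
    A: "is_matrix d {1..n} A" "row_space d A \<subseteq> row_space (d+1) W" "independent_rows d A"
    and a: "\<forall>J. (\<Sum>i\<in>{1..d+1}. e i * V_matrix d n W i J) = a * plucker_vector d n A J" by blast
  have "\<exists>b. v = fscale b (plucker_vector d n A)"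
  proof (cases "\<exists>l\<in>{1..d+1}. c l \<noteq> 0")
    case True
    then show ?thesis using a c by (intro exI[of _ a]) (simp add: e_def fscale_def fun_eq_iff)
  next
    case False
    then show ?thesis using c by (intro exI[of _ 0]) (simp add: fscale_def fun_eq_iff)
  qed
  moreover have "row_space d A \<in> Gr d n" using A(1,3) by (rule row_space_in_Gr)
  ultimately show "v \<in> \<Union> (L_space d n (row_space (d+1) W))"
    using A(1,2) unfolding L_space_def plucker_def by blast
qed


section \<open>Independence of the columns of V\<close>

text \<open>For \<open>J\<close> in \<S>, the nonzero column \<open>J\<close> of V yields a basis
  made of a unit vector and the columns of \<open>W\<close> in \<open>J\<close>. All forms in \<S>
  vanish on the basis vectors belonging to \<open>\<Inter>\<S>\<close>. With more forms than
  remaining basis vectors, a nontrivial combination of them would vanish on the whole basis.\<close>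

lemma card_Inter_le_if_independent_columns:
  fixes W :: "nat \<Rightarrow> nat \<Rightarrow> 'a::field"
  assumes \<S>: "\<S> \<subseteq> nsets {1..n} d" "\<S> \<noteq> {}"
    and ind: "independent_columns (d+1) (V_matrix d n W) \<S>"
  shows "card (\<Inter>\<S>) + card \<S> \<le> d + 1"
proof -
  let ?V = "V_matrix d n W"
  have fin: "finite \<S>" using \<S>(1) by (rule finite_subset) (simp add: finite_imp_finite_nsets)
  obtain J where J: "J \<in> \<S>" using \<S>(2) by blast
  then have J': "J \<in> nsets {1..n} d" "finite J" "card J = d" using \<S>(1) by (auto simp: nsets_def)
  have "\<exists>l\<in>{1..d+1}. ?V l J \<noteq> 0"
  proof (rule ccontr)
    assume "\<not> ?thesis"
    then have zero: "(\<Sum>j\<in>{J}. 1 * ?V i j) = 0" if "i \<in> {1..d+1}" for i using that by simp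
    have "independent_columns (d+1) ?V {J}" using independent_columns_mono[OF ind fin] J by simp
    from this[unfolded independent_columns_def, THEN spec, of "\<lambda>_. 1"] zero show False by simp
  qed
  then obtain l where l: "l \<in> {1..d+1}" "?V l J \<noteq> 0" by blast
  \<comment> \<open>The \<open>l\<close>-th unit vector followed by the columns \<open>J\<close> of
    \<open>W\<close> has determinant \<open>?V l J\<close>, so the columns \<open>cs\<close> of
    \<open>B\<close> form a basis.\<close>
  define B where "B = adjoin (\<lambda>i. if i = l then 1 else 0) W"
  define cs where "cs = None # map Some (sorted_list_of_set J)"
  have "minor B [1..<d+2] cs = (\<Sum>i\<in>{1..d+1}. (if i = l then 1 else 0) * ?V i J)"
    unfolding B_def cs_def by (rule sum_V_matrix[OF J'(1), symmetric])
  also have "\<dots> = ?V l J"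
    using l(1) by (simp add: if_distrib[of "\<lambda>x. x * _"] del: sum.cl_ivl_Suc cong: if_cong)
  finally have "minor B [1..<d+2] cs \<noteq> 0" using l(2) by simp
  moreover have "length cs = length [1..<d+2]" using J' by (simp add: cs_def)
  ultimately have B: "\<forall>y\<in>set cs. (\<Sum>r\<in>set [1..<d+2]. x r * B r y) = 0 \<Longrightarrow> \<forall>r\<in>set [1..<d+2]. x r = 0" for x
    using minor_nonzero_iff_rows[of "[1..<d+2]" cs B] by auto
  have set: "set [1..<d+2] = {1..d+1}" by auto
  \<comment> \<open>The basis vectors on which the forms in \<S> need not all vanish. If the bound
    fails, they are fewer than the forms.\<close>
  define R where "R = set cs - Some ` \<Inter>\<S>"
  show ?thesis
  proof (rule ccontr)
    assume neg: "\<not> ?thesis"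
    have sub: "\<Inter>\<S> \<subseteq> J" using J by blast
    then have "Some ` \<Inter>\<S> \<subseteq> set cs" using J' by (auto simp: cs_def)
    moreover have "card (set cs) = d + 1" using J' by (simp add: cs_def card_image)
    ultimately have "card R = d + 1 - card (\<Inter>\<S>)"
      unfolding R_def using finite_subset[OF sub J'(2)] by (simp add: card_Diff_subset card_image)
    then have "card R < card \<S>" using neg card_mono[OF J'(2) sub] J'(3) by linarith
    then have "\<exists>k. (\<exists>K\<in>\<S>. k K \<noteq> 0) \<and>
        (\<forall>b\<in>R. (\<Sum>K\<in>\<S>. k K * (\<Sum>i\<in>{1..d+1}. B i b * ?V i K)) = 0)"
      by (intro ex_nontrivial_solution) (auto simp: R_def fin)
    then obtain k where k: "\<exists>K\<in>\<S>. k K \<noteq> 0"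
      "\<forall>b\<in>R. (\<Sum>K\<in>\<S>. k K * (\<Sum>i\<in>{1..d+1}. B i b * ?V i K)) = 0" by blast
    \<comment> \<open>The coefficients of the combined form. It vanishes on the basis, hence is 0,
      against the independence of the columns.\<close>
    define x where "x i = (\<Sum>K\<in>\<S>. k K * ?V i K)" for i
    have x: "(\<Sum>i\<in>{1..d+1}. x i * B i b) = (\<Sum>K\<in>\<S>. k K * (\<Sum>i\<in>{1..d+1}. B i b * ?V i K))" for b
      unfolding x_def sum_distrib_left sum_distrib_right by (subst sum.swap) (simp only: mult_ac)
    have "(\<Sum>i\<in>{1..d+1}. x i * B i b) = 0" if b: "b \<in> set cs" for b
    proof (cases "b \<in> R")
      case True
      then show ?thesis unfolding x using k(2) by blast
    next
      case False
      then obtain y where y: "b = Some y" "y \<in> \<Inter>\<S>" using b by (auto simp: R_def)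
      have "(\<Sum>i\<in>{1..d+1}. B i b * ?V i K) = 0" if "K \<in> \<S>" for K
      proof -
        have "K \<in> nsets {1..n} d" "y \<in> K" using that y(2) \<S>(1) by auto
        then show ?thesis
          using sum_column_V_matrix_eq_0[of K n d y W]
          by (simp add: y(1) B_def adjoin_def del: sum.cl_ivl_Suc)
      qed
      then show ?thesis unfolding x by (intro sum.neutral) simp
    qed
    then have "\<forall>i\<in>{1..d+1}. x i = 0" using B[of x] unfolding set by blast
    then show False using ind k(1) unfolding independent_columns_def x_def by blast
  qed
qed

section \<open>Hall's theorem and matrices with prescribed zeros\<close>

text \<open>Induction on \<open>card I\<close>. If a proper nonempty subset \<open>S\<close> is
  tight, \<open>S\<close> is matched first and the rest is matched outside the neighbours of
  \<open>S\<close>. Otherwise one \<open>i\<close> is matched arbitrarily: every other nonempty set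
  has a neighbour to spare.\<close>

lemma hall_marriage:
  assumes "finite I" "\<And>i. i \<in> I \<Longrightarrow> finite (N i)"
    and "\<And>S. S \<subseteq> I \<Longrightarrow> card S \<le> card (\<Union>(N ` S))"
  shows "\<exists>\<sigma>. inj_on \<sigma> I \<and> (\<forall>i\<in>I. \<sigma> i \<in> N i)"
  using assms
proof (induction "card I" arbitrary: I N rule: less_induct)
  case less
  note fin = less.prems(1,2) and hall = less.prems(3)
  show ?case
  proof (cases "\<exists>S. S \<subset> I \<and> S \<noteq> {} \<and> card (\<Union>(N ` S)) = card S")
    case True
    then obtain S where S: "S \<subset> I" "S \<noteq> {}" "card (\<Union>(N ` S)) = card S" by blast
    then have finS: "finite S" "finite (\<Union>(N ` S))" using fin finite_subset[of S I] by auto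
    have "\<exists>\<sigma>. inj_on \<sigma> S \<and> (\<forall>i\<in>S. \<sigma> i \<in> N i)"
      by (rule less.hyps) (use S fin hall finS psubset_card_mono[of I S] in auto)
    then obtain \<sigma> where \<sigma>: "inj_on \<sigma> S" "\<forall>i\<in>S. \<sigma> i \<in> N i" by blast
    define N' where "N' i = N i - \<Union>(N ` S)" for i
    have "\<exists>\<sigma>. inj_on \<sigma> (I - S) \<and> (\<forall>i\<in>I - S. \<sigma> i \<in> N' i)"
    proof (rule less.hyps)
      show "card (I - S) < card I" using S fin(1) by (intro psubset_card_mono) auto
    next
      fix T assume T: "T \<subseteq> I - S"
      then have finT: "finite T" "finite (\<Union>(N ` T))" using fin finite_subset[of T "I - S"] by auto
      \<comment> \<open>Hall's condition for \<open>N'\<close> comes from that for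
        \<open>T \<union> S\<close>, after subtraction of the tight \<open>S\<close>.\<close>
      have "card T + card S = card (T \<union> S)"
        using T finT finS by (subst card_Un_disjoint) auto
      also have "\<dots> \<le> card (\<Union>(N ` (T \<union> S)))" using T S by (intro hall) auto
      also have "\<Union>(N ` (T \<union> S)) = \<Union>(N' ` T) \<union> \<Union>(N ` S)" by (auto simp: N'_def)
      also have "card \<dots> \<le> card (\<Union>(N' ` T)) + card (\<Union>(N ` S))" by (rule card_Un_le)
      finally show "card T \<le> card (\<Union>(N' ` T))" using S(3) by simp
    qed (use fin in \<open>auto simp: N'_def\<close>)
    then obtain \<tau> where \<tau>: "inj_on \<tau> (I - S)" "\<forall>i\<in>I - S. \<tau> i \<in> N' i" by blast
    have "inj_on (\<lambda>i. if i \<in> S then \<sigma> i else \<tau> i) I"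
    proof (rule inj_onI)
      fix i j assume ij: "i \<in> I" "j \<in> I" "(if i \<in> S then \<sigma> i else \<tau> i) = (if j \<in> S then \<sigma> j else \<tau> j)"
      have "\<sigma> i \<noteq> \<tau> j" if "i \<in> S" "j \<in> I - S" for i j
      proof -
        have "\<sigma> i \<in> \<Union>(N ` S)" using that \<sigma>(2) by auto
        moreover have "\<tau> j \<notin> \<Union>(N ` S)" using that \<tau>(2) unfolding N'_def by auto
        ultimately show ?thesis by metis
      qed
      with ij show "i = j"
        using inj_onD[OF \<sigma>(1)] inj_onD[OF \<tau>(1)] by (cases "i \<in> S"; cases "j \<in> S") (simp_all, metis DiffI)
    qed
    moreover have "\<forall>i\<in>I. (if i \<in> S then \<sigma> i else \<tau> i) \<in> N i"
      using \<sigma>(2) \<tau>(2) by (auto simp: N'_def)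
    ultimately show ?thesis by blast
  next
    case untight: False
    show ?thesis
    proof (cases "I = {}")
      case nonempty: False
      then obtain i where i: "i \<in> I" by blast
      have "card {i} \<le> card (\<Union>(N ` {i}))" using i by (intro hall) auto
      then obtain x where x: "x \<in> N i" using fin(2)[OF i] by fastforce
      have "\<exists>\<sigma>. inj_on \<sigma> (I - {i}) \<and> (\<forall>j\<in>I - {i}. \<sigma> j \<in> N j - {x})"
      proof (rule less.hyps)
        show "card (I - {i}) < card I" using i fin(1) by (intro psubset_card_mono) auto
      next
        fix T assume T: "T \<subseteq> I - {i}"
        show "card T \<le> card (\<Union>j\<in>T. N j - {x})"
        proof (cases "T = {}")
          case False
          with T i have "T \<subset> I \<and> T \<noteq> {}" by blast
          then have "card (\<Union>(N ` T)) \<noteq> card T" using untight by blast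
          moreover have "card T \<le> card (\<Union>(N ` T))" using T by (intro hall) auto
          ultimately have "card T < card (\<Union>(N ` T))" by simp
          moreover have "(\<Union>j\<in>T. N j - {x}) = \<Union>(N ` T) - {x}" by blast
          ultimately show ?thesis by (auto simp: card_Diff_singleton_if)
        qed simp
      qed (use fin in auto)
      then obtain \<sigma> where \<sigma>: "inj_on \<sigma> (I - {i})" "\<forall>j\<in>I - {i}. \<sigma> j \<in> N j - {x}" by blast
      then have "inj_on (\<sigma>(i := x)) I" by (auto simp: inj_on_def)
      moreover have "\<forall>j\<in>I. (\<sigma>(i := x)) j \<in> N j" using \<sigma>(2) x by auto
      ultimately show ?thesis by blast
    qed simp
  qed
qed

text \<open>Hall's theorem matches the rows other than \<open>l\<close> with the columns in
  \<open>Z l\<close>, avoiding \<open>Z i\<close> in each row \<open>i \<le> m\<close>; row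
  \<open>l\<close> receives \<open>x\<close>. The 0-1 matrix of this matching has the required zeros
  and a nonzero minor.\<close>

lemma ex_matching_matrix:
  fixes Z :: "nat \<Rightarrow> nat set"
  assumes Z: "\<And>i. i \<in> {1..m} \<Longrightarrow> Z i \<in> nsets {1..n} d"
    and cond: "\<And>T. T \<subseteq> {1..m} \<Longrightarrow> T \<noteq> {} \<Longrightarrow> card (\<Inter>(Z ` T)) + card T \<le> d + 1"
    and l: "l \<in> {1..m}" and x: "x \<in> {1..n} - Z l"
  shows "\<exists>G :: nat \<Rightarrow> nat \<Rightarrow> 'a::field.
    (\<forall>i j. (i, j) \<notin> {(i, j). i \<in> {1..d+1} \<and> j \<in> {1..n} \<and> (i \<le> m \<longrightarrow> j \<notin> Z i)} \<longrightarrow> G i j = 0) \<and>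
    minor G [1..<d+2] (x # sorted_list_of_set (Z l)) \<noteq> 0"
proof -
  have m: "m \<le> d + 1" using cond[of "{1..m}"] l by auto
  have Zl: "finite (Z l)" "card (Z l) = d" "Z l \<subseteq> {1..n}" using Z[OF l] by (auto simp: nsets_def)
  define I where "I = {1..d+1} - {l}"
  have I: "finite I" "card I = d" using l m by (auto simp: I_def)
  define N where "N i = (if i \<le> m then Z l - Z i else Z l)" for i
  have "\<exists>\<sigma>. inj_on \<sigma> I \<and> (\<forall>i\<in>I. \<sigma> i \<in> N i)"
  proof (rule hall_marriage)
    fix S assume S: "S \<subseteq> I"
    then have finS: "finite S" "card S \<le> d" using I card_mono finite_subset by metis+
    consider "S = {}" | i where "i \<in> S" "m < i" | "S \<noteq> {}" "\<forall>i\<in>S. i \<le> m" by force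
    then show "card S \<le> card (\<Union>(N ` S))"
    proof cases
      \<comment> \<open>A row beyond \<open>m\<close> is unrestricted, so it alone has all
        \<open>d\<close> elements of \<open>Z l\<close> as neighbours.\<close>
      case 2
      then have "\<Union>(N ` S) = Z l" by (auto simp: N_def)
      then show ?thesis using finS Zl by simp
    next
      case 3
      \<comment> \<open>The neighbours of \<open>S\<close> are \<open>Z l\<close> minus the
        intersection over \<open>?T\<close>. As \<open>?T\<close> has one element more than
        \<open>S\<close>, its intersection condition is exactly Hall's condition for
        \<open>S\<close>.\<close>
      let ?T = "insert l S"
      have T: "?T \<subseteq> {1..m}" using 3 S l by (auto simp: I_def)
      have sub: "\<Inter>(Z ` ?T) \<subseteq> Z l" by blast
      have "\<Union>(N ` S) = Z l - \<Inter>(Z ` ?T)" using 3 by (auto simp: N_def)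
      then have "card (\<Union>(N ` S)) = d - card (\<Inter>(Z ` ?T))"
        using Zl finite_subset[OF sub] by (simp add: card_Diff_subset sub)
      moreover have "card ?T = card S + 1" using finS S by (simp add: I_def subset_Diff_insert)
      moreover have "card (\<Inter>(Z ` ?T)) \<le> d" using card_mono[OF Zl(1) sub] Zl(2) by simp
      ultimately show ?thesis using cond[OF T] by simp
    qed simp
  qed (use I Zl in \<open>auto simp: N_def\<close>)
  then obtain \<sigma> where \<sigma>: "inj_on \<sigma> I" "\<forall>i\<in>I. \<sigma> i \<in> N i" by blast
  define \<tau> where "\<tau> = \<sigma>(l := x)"
  define cs where "cs = x # sorted_list_of_set (Z l)"
  have cs: "distinct cs" "length cs = length [1..<d+2]" "set cs = insert x (Z l)"
    using Zl x by (auto simp: cs_def)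
  have rs: "{1..d+1} = insert l I" "l \<notin> I" using l m by (auto simp: I_def)
  have N: "N i \<subseteq> Z l" for i by (auto simp: N_def)
  have "\<tau> ` {1..d+1} \<subseteq> set cs" using \<sigma>(2) N cs(3) rs by (auto simp: \<tau>_def)
  moreover have "inj_on \<tau> {1..d+1}"
  proof -
    have "x \<notin> \<sigma> ` I" using \<sigma>(2) N x by blast
    then show ?thesis unfolding rs(1) using \<sigma>(1) rs(2) by (auto simp: \<tau>_def inj_on_def)
  qed
  moreover have "card (set cs) = d + 1" using distinct_card[OF cs(1)] cs(2) by simp
  ultimately have surj: "\<tau> ` {1..d+1} = set cs"
    by (intro card_subset_eq) (auto simp: card_image)
  define G :: "nat \<Rightarrow> nat \<Rightarrow> 'a" where "G i j = (if i \<in> {1..d+1} \<and> j = \<tau> i then 1 else 0)" for i j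
  have "minor G [1..<d+2] cs \<noteq> 0"
  proof (subst minor_nonzero_iff[OF cs(1,2)], intro allI impI)
    fix k assume k: "\<forall>r\<in>set [1..<d+2]. (\<Sum>y\<in>set cs. k y * G r y) = 0"
    have "k (\<tau> r) = 0" if r: "r \<in> {1..d+1}" for r
    proof -
      have "(\<Sum>y\<in>set cs. k y * G r y) = (\<Sum>y\<in>{\<tau> r}. k y * G r y)"
        by (rule sum.mono_neutral_right) (use r surj in \<open>auto simp: G_def\<close>)
      moreover have "(\<Sum>y\<in>set cs. k y * G r y) = 0" by (rule bspec[OF k]) (use r in auto)
      ultimately show ?thesis using r by (simp add: G_def)
    qed
    then show "\<forall>y\<in>set cs. k y = 0" unfolding surj[symmetric] by blast
  qed
  moreover have "\<tau> i \<in> {1..n} \<and> (i \<le> m \<longrightarrow> \<tau> i \<notin> Z i)" if "i \<in> {1..d+1}" for i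
  proof (cases "i = l")
    case False
    then have "\<tau> i \<in> N i" using \<sigma>(2) that by (simp add: \<tau>_def I_def)
    then show ?thesis using Zl(3) by (auto simp: N_def split: if_splits)
  qed (use x in \<open>simp add: \<tau>_def\<close>)
  ultimately show ?thesis unfolding cs_def by (intro exI[of _ G]) (auto simp: G_def)
qed

lemma ex_independent_columns:
  assumes inf: "infinite (UNIV :: 'a::field set)" and n: "n \<ge> d + 1"
    and \<J>: "\<J> \<subseteq> nsets {1..n} d" "\<J> \<noteq> {}"
    and cond: "\<And>\<S>. \<S> \<subseteq> \<J> \<Longrightarrow> \<S> \<noteq> {} \<Longrightarrow> card (\<Inter>\<S>) + card \<S> \<le> d + 1"
  shows "\<exists>(G :: nat \<Rightarrow> nat \<Rightarrow> 'a) C. is_matrix (d+1) {1..n} G \<and>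
    independent_columns (d+1) (V_matrix d n G) \<J> \<and>
    C \<subseteq> {1..n} \<and> card C = d + 1 \<and> minor G [1..<d+2] (sorted_list_of_set C) \<noteq> 0"
proof -
  have fin: "finite \<J>" using \<J>(1) by (rule finite_subset) (simp add: finite_imp_finite_nsets)
  define m where "m = card \<J>"
  obtain Z where Z: "bij_betw Z {1..m} \<J>" using ex_bij_betw_nat_finite_1[OF fin] m_def by blast
  have Zn: "Z i \<in> nsets {1..n} d" if "i \<in> {1..m}" for i using bij_betwE[OF Z] that \<J>(1) by blast
  have condZ: "card (\<Inter>(Z ` T)) + card T \<le> d + 1" if T: "T \<subseteq> {1..m}" "T \<noteq> {}" for T
  proof -
    have "card (Z ` T) = card T"
      using T(1) Z by (meson bij_betw_def card_image inj_on_subset)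
    moreover have "Z ` T \<subseteq> \<J>" using T(1) bij_betw_imp_surj_on[OF Z] by blast
    ultimately show ?thesis using cond[of "Z ` T"] T(2) by simp
  qed
  \<comment> \<open>The condition for \<J> itself gives \<open>m \<le> d + 1\<close>, so every
    \<open>Z i\<close> has its own row of \<open>G\<close>.\<close>
  have m: "1 \<in> {1..m}" "m \<le> d + 1"
    using cond[OF order_refl \<J>(2)] fin \<J>(2) by (auto simp: m_def Suc_le_eq card_gt_0_iff)
  have "\<exists>x. x \<in> {1..n} - Z i" if "i \<in> {1..m}" for i
  proof (rule ccontr)
    assume "\<not> ?thesis"
    then have "card {1..n} \<le> card (Z i)" using Zn[OF that] by (intro card_mono) (auto simp: nsets_def)
    then show False using Zn[OF that] n by (auto simp: nsets_def)
  qed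
  \<comment> \<open>A column outside \<open>Z i\<close>: the minor on \<open>x i\<close> and
    \<open>Z i\<close> is a combination of the entries of column \<open>Z i\<close> of V, so if it
    is nonzero, so is that column.\<close>
  then obtain x where x: "\<And>i. i \<in> {1..m} \<Longrightarrow> x i \<in> {1..n} - Z i" by metis
  define cs where "cs i = x i # sorted_list_of_set (Z i)" for i
  let ?S = "{(i, j). i \<in> {1..d+1} \<and> j \<in> {1..n} \<and> (i \<le> m \<longrightarrow> j \<notin> Z i)}"
  \<comment> \<open>Matchings make each of the \<open>m\<close> minors nonzero separately; one
    matrix with the same zero pattern then serves all of them.\<close>
  have "\<exists>G :: nat \<Rightarrow> nat \<Rightarrow> 'a. (\<forall>i j. (i, j) \<notin> ?S \<longrightarrow> G i j = 0) \<and>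
      (\<forall>(rs, cs)\<in>(\<lambda>i. ([1..<d+2], cs i)) ` {1..m}. minor G rs cs \<noteq> 0)"
  proof (rule ex_common_nonzero_minors[OF inf])
    fix rs cs' assume "(rs, cs') \<in> (\<lambda>i. ([1..<d+2], cs i)) ` {1..m}"
    then obtain l where l: "l \<in> {1..m}" "rs = [1..<d+2]" "cs' = cs l" by blast
    show "\<exists>G :: nat \<Rightarrow> nat \<Rightarrow> 'a. (\<forall>i j. (i, j) \<notin> ?S \<longrightarrow> G i j = 0) \<and> minor G rs cs' \<noteq> 0"
      unfolding l(2,3) cs_def using Zn condZ l(1) x[OF l(1)] by (rule ex_matching_matrix)
  qed simp
  then obtain G :: "nat \<Rightarrow> nat \<Rightarrow> 'a" where G: "\<forall>i j. (i, j) \<notin> ?S \<longrightarrow> G i j = 0"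
    and minor: "\<And>i. i \<in> {1..m} \<Longrightarrow> minor G [1..<d+2] (cs i) \<noteq> 0" by auto
  let ?V = "V_matrix d n G"
  have set: "set [1..<d+2] = {1..d+1}" by auto
  \<comment> \<open>\<open>?V a (Z i)\<close> is the determinant of the \<open>a\<close>-th unit
    vector followed by the columns \<open>Z i\<close> of \<open>G\<close>. Its row \<open>i\<close>
    is zero, because \<open>a \<noteq> i\<close> and row \<open>i\<close> of \<open>G\<close>
    vanishes on \<open>Z i\<close>.\<close>
  have offdiag: "?V a (Z i) = 0" if i: "i \<in> {1..m}" and a: "a \<in> {1..d+1}" "a \<noteq> i" for i a
  proof -
    define e :: "nat \<Rightarrow> 'a" where "e = (\<lambda>r. if r = a then 1 else 0)"
    let ?cs = "None # map Some (sorted_list_of_set (Z i))"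
    have Zi: "finite (Z i)" "card (Z i) = d" using Zn[OF i] by (auto simp: nsets_def)
    have "adjoin e G i y = 0" if "y \<in> set ?cs" for y
      using that a(2) G i m(2) Zi(1) by (auto simp: adjoin_def e_def)
    moreover have "(\<Sum>r\<in>{1..d+1}. (if r = i then 1 else 0) * adjoin e G r y) = adjoin e G i y" for y
      using i m(2) by (simp add: if_distrib[of "\<lambda>x. x * _"] del: sum.cl_ivl_Suc cong: if_cong)
    ultimately have rel: "\<forall>y\<in>set ?cs. (\<Sum>r\<in>{1..d+1}. (if r = i then 1 else 0) * adjoin e G r y) = 0"
      by simp
    have len: "length ?cs = length [1..<d+2]" using Zi by simp
    have "minor (adjoin e G) [1..<d+2] ?cs = 0"
    proof (rule ccontr)
      assume "minor (adjoin e G) [1..<d+2] ?cs \<noteq> 0"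
      from minor_nonzero_iff_rows[OF distinct_upt len, THEN iffD1, OF this, unfolded set, THEN spec,
          of "\<lambda>r. if r = i then 1 else 0"] rel
      have "\<forall>r\<in>{1..d+1}. (if r = i then 1 else 0) = (0 :: 'a)" by blast
      from bspec[OF this, of i] show False using i m(2) by simp
    qed
    then have "(\<Sum>r\<in>{1..d+1}. e r * ?V r (Z i)) = 0" using sum_V_matrix[OF Zn[OF i], of e G] by simp
    then show ?thesis
      using a(1) by (simp add: e_def if_distrib[of "\<lambda>x. x * _"] del: sum.cl_ivl_Suc cong: if_cong)
  qed
  have diag: "?V i (Z i) \<noteq> 0" if i: "i \<in> {1..m}" for i
  proof
    assume "?V i (Z i) = 0"
    then have "?V r (Z i) = 0" if "r \<in> {1..d+1}" for r using offdiag[OF i that] by (cases "r = i") auto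
    then have "(\<Sum>r\<in>{1..d+1}. G r (x i) * ?V r (Z i)) = 0" by (intro sum.neutral) simp
    then show False
      using sum_column_V_matrix[OF Zn[OF i], of G "x i"] minor[OF i] by (simp add: cs_def)
  qed
  have "independent_columns (d+1) ?V \<J>"
    unfolding independent_columns_def
  proof (intro allI impI ballI)
    fix k J assume k: "\<forall>i\<in>{1..d+1}. (\<Sum>K\<in>\<J>. k K * ?V i K) = 0" and J: "J \<in> \<J>"
    obtain i where i: "i \<in> {1..m}" "J = Z i" using J bij_betw_imp_surj_on[OF Z] by blast
    have "(\<Sum>K\<in>\<J>. k K * ?V i K) = (\<Sum>K\<in>{J}. k K * ?V i K)"
    proof (rule sum.mono_neutral_right)
      show "\<forall>K\<in>\<J> - {J}. k K * ?V i K = 0"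
      proof
        fix K assume K: "K \<in> \<J> - {J}"
        then obtain i' where "i' \<in> {1..m}" "K = Z i'" using bij_betw_imp_surj_on[OF Z] by blast
        then show "k K * ?V i K = 0" using offdiag[of i' i] K i m(2) by auto
      qed
    qed (use fin J in auto)
    then show "k J = 0" using k i m(2) diag[OF i(1)] by auto
  qed
  moreover have "is_matrix (d+1) {1..n} G" using G by (auto simp: is_matrix_def coord_space_def)
  \<comment> \<open>The columns of the first of the nonzero minors. They certify that the rows of
    \<open>G\<close> are independent and lead to a basis of the matroid in
    \<open>independent_columns_complements\<close>.\<close>
  moreover obtain C where C: "C = insert (x 1) (Z 1)" by simp
  have Z1: "finite (Z 1)" "card (Z 1) = d" "Z 1 \<subseteq> {1..n}" "x 1 \<in> {1..n}" "x 1 \<notin> Z 1"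
    using Zn[OF m(1)] x[OF m(1)] by (auto simp: nsets_def)
  then have "C \<subseteq> {1..n}" "card C = d + 1" "finite C" by (auto simp: C)
  moreover have "distinct (cs 1)" "set (cs 1) = C" using Z1 by (auto simp: cs_def C)
  then have "minor G [1..<d+2] (sorted_list_of_set C) \<noteq> 0"
    using minor[OF m(1)] \<open>finite C\<close> \<open>card C = d + 1\<close> Z1
    by (subst minor_nonzero_iff_same_columns[of _ "cs 1"]) (auto simp: cs_def)
  ultimately show ?thesis by blast
qed

text \<open>The form \<open>C - {y}\<close> vanishes at the columns of \<open>G\<close> in
  \<open>C\<close> other than \<open>y\<close>, but not at column \<open>y\<close>. Evaluating a
  relation at column \<open>y\<close> therefore isolates one coefficient.\<close>

lemma independent_columns_complements:
  fixes G :: "nat \<Rightarrow> nat \<Rightarrow> 'a::field"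
  assumes C: "C \<subseteq> {1..n}" "card C = d + 1" and minor: "minor G [1..<d+2] (sorted_list_of_set C) \<noteq> 0"
  defines "\<C> \<equiv> (\<lambda>y. C - {y}) ` C"
  shows "\<C> \<subseteq> nsets {1..n} d" "card \<C> = d + 1" "independent_columns (d+1) (V_matrix d n G) \<C>"
proof -
  let ?V = "V_matrix d n G"
  have fin: "finite C" using C(1) finite_subset by blast
  show sub: "\<C> \<subseteq> nsets {1..n} d" using C fin by (auto simp: \<C>_def nsets_def)
  have inj: "inj_on (\<lambda>y. C - {y}) C" by (rule inj_onI) blast
  then show "card \<C> = d + 1" using C(2) by (simp add: \<C>_def card_image)
  show "independent_columns (d+1) ?V \<C>"
    unfolding independent_columns_def
  proof (intro allI impI ballI)
    fix k J assume k: "\<forall>i\<in>{1..d+1}. (\<Sum>K\<in>\<C>. k K * ?V i K) = 0" and J: "J \<in> \<C>"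
    then obtain y where y: "y \<in> C" "J = C - {y}" by (auto simp: \<C>_def)
    have "minor G [1..<d+2] (y # sorted_list_of_set J) \<noteq> 0"
    proof -
      have "set (y # sorted_list_of_set J) = set (sorted_list_of_set C)"
        "distinct (y # sorted_list_of_set J)"
        "length (y # sorted_list_of_set J) = length [1..<d+2]" using y fin C(2) by auto
      then show ?thesis
        using minor C(2) by (subst minor_nonzero_iff_same_columns[of _ "sorted_list_of_set C"]) auto
    qed
    moreover have "k J * minor G [1..<d+2] (y # sorted_list_of_set J) = 0"
    proof -
      have "k J * minor G [1..<d+2] (y # sorted_list_of_set J) =
          (\<Sum>K\<in>{J}. k K * (\<Sum>i\<in>{1..d+1}. G i y * ?V i K))"
        using sum_column_V_matrix[of J n d G y] J sub by auto
      also have "\<dots> = (\<Sum>K\<in>\<C>. k K * (\<Sum>i\<in>{1..d+1}. G i y * ?V i K))"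
      proof (rule sum.mono_neutral_left)
        show "\<forall>K\<in>\<C> - {J}. k K * (\<Sum>i\<in>{1..d+1}. G i y * ?V i K) = 0"
        proof
          fix K assume K: "K \<in> \<C> - {J}"
          then have "y \<in> K" "K \<in> nsets {1..n} d" using y sub by (auto simp: \<C>_def)
          then show "k K * (\<Sum>i\<in>{1..d+1}. G i y * ?V i K) = 0"
            using sum_column_V_matrix_eq_0 by (metis mult_zero_right)
        qed
      qed (use J fin in \<open>auto simp: \<C>_def\<close>)
      also have "\<dots> = (\<Sum>i\<in>{1..d+1}. G i y * (\<Sum>K\<in>\<C>. k K * ?V i K))"
        unfolding sum_distrib_left by (subst sum.swap) (simp only: mult_ac)
      also have "\<dots> = 0" using k by (intro sum.neutral) simp
      finally show ?thesis .
    qed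
    ultimately show "k J = 0" by simp
  qed
qed

section \<open>Transfer to generic subspaces\<close>

text \<open>Genericity concerns only \<open>d + 1\<close> columns at a time, so \<J> is first
  enlarged to \<open>K\<close> of that size, independent for \<open>G\<close>; the complements in
  \<open>C\<close> supply an independent set of the right cardinality to draw from.\<close>

lemma generic_independent_columns:
  fixes W :: "nat \<Rightarrow> nat \<Rightarrow> 'a::field"
  assumes inf: "infinite (UNIV :: 'a set)" and n: "n \<ge> d + 1"
    and gen: "generic d n (row_space (d+1) W)" and W: "is_matrix (d+1) {1..n} W"
    and \<J>: "\<J> \<subseteq> nsets {1..n} d"
    and cond: "\<And>\<S>. \<S> \<subseteq> \<J> \<Longrightarrow> \<S> \<noteq> {} \<Longrightarrow> card (\<Inter>\<S>) + card \<S> \<le> d + 1"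
  shows "independent_columns (d+1) (V_matrix d n W) \<J>"
proof (cases "\<J> = {}")
  case False
  let ?E = "nsets {1..n} d"
  have finE: "finite ?E" by (simp add: finite_imp_finite_nsets)
  obtain G :: "nat \<Rightarrow> nat \<Rightarrow> 'a" and C where G: "is_matrix (d+1) {1..n} G"
    "independent_columns (d+1) (V_matrix d n G) \<J>"
    and C: "C \<subseteq> {1..n}" "card C = d + 1" "minor G [1..<d+2] (sorted_list_of_set C) \<noteq> 0"
    using ex_independent_columns[OF inf n \<J> False cond] by blast
  define M where "M = linear_matroid ?E (row_space (d+1) (V_matrix d n G))"
  have indep: "I \<in> indep M \<longleftrightarrow> I \<subseteq> ?E \<and> independent_columns (d+1) (V_matrix d n G) I" for I
    unfolding M_def by (rule indep_linear_matroid_iff[OF finE V_matrix_is_matrix])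
  have "is_matroid M"
    unfolding M_def by (rule is_matroid_linear_matroid[OF finE V_matrix_is_matrix])
  moreover note \<C> = independent_columns_complements[OF C]
  have "card \<J> \<le> d + 1" using cond[OF order_refl False] by simp
  ultimately obtain K where K: "K \<in> indep M" "\<J> \<subseteq> K" "card K = d + 1"
    using is_matroid_extend_indep[of M \<J> "(\<lambda>y. C - {y}) ` C"] \<C> indep G(2) \<J> by auto
  have finK: "finite K" using K(3) card_ge_0_finite[of K] by simp
  then obtain Js where Js: "set Js = K" "distinct Js" using finite_distinct_list by blast
  then have len: "length Js = d + 1" using K(3) distinct_card by metis
  have set: "set [1..<d+2] = {1..d+1}" by auto
  have iff: "minor (V_matrix d n A) [1..<d+2] Js \<noteq> 0 \<longleftrightarrow>
      independent_columns (d+1) (V_matrix d n A) K" for A :: "nat \<Rightarrow> nat \<Rightarrow> 'a"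
    using minor_nonzero_iff[OF Js(2), of "[1..<d+2]" "V_matrix d n A"] len
    unfolding independent_columns_def set Js(1) by simp
  \<comment> \<open>\<open>G\<close> witnesses that the maximal minor on \<open>Js\<close> is not
    identically zero.\<close>
  have "row_space (d+1) G \<in> Gr (d+1) n"
    using G(1) independent_rows_if_minor[OF C(3)] C(2) by (intro row_space_in_Gr) auto
  moreover have "minor (V_matrix d n G) [1..<d+2] Js \<noteq> 0" using iff indep K(1) by blast
  moreover have "set Js \<subseteq> ?E" using Js(1) indep K(1) by blast
  ultimately have "minor (V_matrix d n W) [1..<d+2] Js \<noteq> 0"
    using gen W G(1) Js(2) len unfolding generic_def by blast
  then show ?thesis using iff K(2) finK independent_columns_mono by blast
qed (simp add: independent_columns_def)

lemma indep_matroid_of_L_iff: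
  fixes X :: "(nat \<Rightarrow> 'a::field) set"
  assumes inf: "infinite (UNIV :: 'a set)" and n: "n \<ge> d + 1" and gen: "generic d n X"
  shows "\<J> \<in> indep (matroid_of_L d n X) \<longleftrightarrow> \<J> \<subseteq> nsets {1..n} d \<and>
    (\<forall>\<S>\<subseteq>\<J>. \<S> \<noteq> {} \<longrightarrow> card (\<Inter>\<S>) + card \<S> \<le> d + 1)"
proof -
  have X: "X \<in> Gr (d+1) n" using gen by (simp add: generic_def)
  obtain W where W: "is_matrix (d+1) {1..n} W" "row_space (d+1) W = X"
    using Gr_ex_matrix[OF X] by auto
  have "independent_rows (d+1) W"
    using X dim_row_space_iff[of "d+1" W] W(2) by (simp add: Gr_def)
  then have "\<Union> (L_space d n X) = row_space (d+1) (V_matrix d n W)"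
    using Union_L_space[OF W(1)] W(2) by simp
  then have "\<J> \<in> indep (matroid_of_L d n X) \<longleftrightarrow>
      \<J> \<subseteq> nsets {1..n} d \<and> independent_columns (d+1) (V_matrix d n W) \<J>"
    unfolding matroid_of_L_def
    by (simp only: indep_linear_matroid_iff[OF finite_imp_finite_nsets[OF finite_atLeastAtMost]
          V_matrix_is_matrix])
  also have "\<dots> \<longleftrightarrow> \<J> \<subseteq> nsets {1..n} d \<and>
      (\<forall>\<S>\<subseteq>\<J>. \<S> \<noteq> {} \<longrightarrow> card (\<Inter>\<S>) + card \<S> \<le> d + 1)"
  proof (intro conj_cong refl iffI allI impI)
    fix \<S> assume \<J>: "\<J> \<subseteq> nsets {1..n} d" and "independent_columns (d+1) (V_matrix d n W) \<J>"
      and "\<S> \<subseteq> \<J>" "\<S> \<noteq> {}"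
    moreover have "finite \<J>" using \<J> by (rule finite_subset) (simp add: finite_imp_finite_nsets)
    ultimately show "card (\<Inter>\<S>) + card \<S> \<le> d + 1"
      by (intro card_Inter_le_if_independent_columns[of _ n _ W])
        (auto intro: independent_columns_mono)
  next
    assume "\<J> \<subseteq> nsets {1..n} d" "\<forall>\<S>\<subseteq>\<J>. \<S> \<noteq> {} \<longrightarrow> card (\<Inter>\<S>) + card \<S> \<le> d + 1"
    then show "independent_columns (d+1) (V_matrix d n W) \<J>"
      using gen W by (intro generic_independent_columns[OF inf n]) auto
  qed
  finally show ?thesis .
qed


section \<open>The Dilworth truncation\<close>

lemma flats_free_matroid:
  assumes "finite E"
  shows "{F. flat (free_matroid E) F \<and> rk (free_matroid E) F = k} = nsets E k"
proof -
  have "rk (free_matroid E) F < rk (free_matroid E) (insert x F)" if "F \<subseteq> E" "x \<in> E - F" for F x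
    using that assms finite_subset[OF that(1)] by (subst (1 2) rk_free_matroid) auto
  then have "flat (free_matroid E) F \<longleftrightarrow> F \<subseteq> E" for F
    unfolding flat_def by (auto simp: free_matroid_def)
  then show ?thesis using assms by (auto simp: nsets_def rk_free_matroid dest: finite_subset)
qed

text \<open>Complementation is an involution that turns intersections into unions, and rank in the
  free matroid is cardinality. So the rank bound reads
  \<open>card \<S> + (n - d) - 1 \<le> n - card (\<Inter>\<S>)\<close>, which rearranges to the
  intersection condition.\<close>

lemma indep_dilworth_compl_iff:
  assumes n: "n \<ge> d + 1"
  shows "\<J> \<in> indep (dilworth_compl (n - d) n) \<longleftrightarrow> \<J> \<subseteq> nsets {1..n} d \<and>
    (\<forall>\<S>\<subseteq>\<J>. \<S> \<noteq> {} \<longrightarrow> card (\<Inter>\<S>) + card \<S> \<le> d + 1)"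
proof -
  define f where "f = (\<lambda>J. {1..n} - J)"
  let ?D = "dilworth (n - d) (free_matroid {1..n})"
  have ff: "f (f J) = J" if "J \<subseteq> {1..n}" for J using that by (auto simp: f_def)
  have f_nsets: "f J \<in> nsets {1..n} (n - k)" if "J \<in> nsets {1..n} k" for J k
    using that by (auto simp: f_def nsets_def card_Diff_subset)
  have ff': "f ` f ` \<J> = \<J>" if "\<J> \<subseteq> nsets {1..n} k" for \<J> k
  proof -
    have "f (f J) = J" if "J \<in> \<J>" for J using ff that \<open>\<J> \<subseteq> _\<close> by (auto simp: nsets_def)
    then show ?thesis by (simp add: image_image)
  qed
  have D: "\<I> \<in> indep ?D \<longleftrightarrow> \<I> \<subseteq> nsets {1..n} (n - d) \<and>
      (\<forall>s>0. \<forall>\<S>\<subseteq>\<I>. card \<S> = s \<longrightarrow> rk (free_matroid {1..n}) (\<Union>\<S>) \<ge> s + (n - d) - 1)" for \<I>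
    unfolding dilworth_def Let_def flats_free_matroid[OF finite_atLeastAtMost] by simp
  have "\<J> \<in> indep (dilworth_compl (n - d) n) \<longleftrightarrow> \<J> \<in> image f ` indep ?D"
    by (simp add: dilworth_compl_def relabel_def f_def)
  also have "\<dots> \<longleftrightarrow> \<J> \<subseteq> nsets {1..n} d \<and> f ` \<J> \<in> indep ?D"
  proof
    assume "\<J> \<in> image f ` indep ?D"
    then obtain \<I> where \<I>: "\<I> \<in> indep ?D" "\<J> = f ` \<I>" by blast
    then have sub: "\<I> \<subseteq> nsets {1..n} (n - d)" using D by blast
    then have "f ` \<I> \<subseteq> nsets {1..n} (n - (n - d))" using f_nsets by blast
    then show "\<J> \<subseteq> nsets {1..n} d \<and> f ` \<J> \<in> indep ?D" using \<I> n ff'[OF sub] by simp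
  next
    assume "\<J> \<subseteq> nsets {1..n} d \<and> f ` \<J> \<in> indep ?D"
    then show "\<J> \<in> image f ` indep ?D" using ff' by (metis imageI)
  qed
  also have "\<dots> \<longleftrightarrow> \<J> \<subseteq> nsets {1..n} d \<and>
    (\<forall>\<S>\<subseteq>\<J>. \<S> \<noteq> {} \<longrightarrow> card (\<Inter>\<S>) + card \<S> \<le> d + 1)"
  proof (intro conj_cong refl)
    assume \<J>: "\<J> \<subseteq> nsets {1..n} d"
    have fin: "finite \<J>" using \<J> by (rule finite_subset) (simp add: finite_imp_finite_nsets)
    have inj: "inj_on f \<J>" using ff \<J> by (intro inj_on_inverseI[of _ f]) (auto simp: nsets_def)
    \<comment> \<open>The bounds \<open>card \<S> > 0\<close>,
      \<open>card (\<Inter>\<S>) \<le> n\<close> and \<open>d < n\<close> make all the truncated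
      subtractions exact.\<close>
    have key: "card (f ` \<S>) + (n - d) - 1 \<le> rk (free_matroid {1..n}) (\<Union>(f ` \<S>)) \<longleftrightarrow>
        card (\<Inter>\<S>) + card \<S> \<le> d + 1" if \<S>: "\<S> \<subseteq> \<J>" "\<S> \<noteq> {}" for \<S>
    proof -
      obtain J where "J \<in> \<S>" using \<S>(2) by blast
      then have "\<Inter>\<S> \<subseteq> J" "J \<in> nsets {1..n} d" using \<S>(1) \<J> by blast+
      then have sub: "\<Inter>\<S> \<subseteq> {1..n}" by (auto simp: nsets_def)
      have "\<Union>(f ` \<S>) = {1..n} - \<Inter>\<S>" using \<S>(2) by (auto simp: f_def)
      then have "rk (free_matroid {1..n}) (\<Union>(f ` \<S>)) = n - card (\<Inter>\<S>)"
        using finite_subset[OF sub] sub by (simp add: rk_free_matroid card_Diff_subset)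
      moreover have "card (f ` \<S>) = card \<S>" using inj \<S>(1) by (meson card_image inj_on_subset)
      moreover have "card (\<Inter>\<S>) \<le> n" using card_mono[OF _ sub] by simp
      moreover have "card \<S> > 0" using \<S> fin finite_subset by (auto simp: card_gt_0_iff)
      ultimately show ?thesis using n by linarith
    qed
    have "f ` \<J> \<in> indep ?D \<longleftrightarrow> (\<forall>\<T>\<subseteq>f ` \<J>. card \<T> > 0 \<longrightarrow>
        card \<T> + (n - d) - 1 \<le> rk (free_matroid {1..n}) (\<Union>\<T>))"
      unfolding D using \<J> f_nsets by blast
    also have "\<dots> \<longleftrightarrow> (\<forall>\<S>\<subseteq>\<J>. card (f ` \<S>) > 0 \<longrightarrow>
        card (f ` \<S>) + (n - d) - 1 \<le> rk (free_matroid {1..n}) (\<Union>(f ` \<S>)))"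
      unfolding all_subset_image ..
    also have "\<dots> \<longleftrightarrow> (\<forall>\<S>\<subseteq>\<J>. \<S> \<noteq> {} \<longrightarrow> card (\<Inter>\<S>) + card \<S> \<le> d + 1)"
    proof -
      have "card (f ` \<S>) > 0 \<longleftrightarrow> \<S> \<noteq> {}" if "\<S> \<subseteq> \<J>" for \<S>
        using fin finite_subset[OF that] by (auto simp: card_gt_0_iff)
      then show ?thesis using key by blast
    qed
    finally show "f ` \<J> \<in> indep ?D \<longleftrightarrow>
      (\<forall>\<S>\<subseteq>\<J>. \<S> \<noteq> {} \<longrightarrow> card (\<Inter>\<S>) + card \<S> \<le> d + 1)" .
  qed
  finally show ?thesis .
qed

theorem theorem16:
  fixes X :: "(nat \<Rightarrow> 'a::alg_closed_field) set" and d n :: nat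
  assumes "n \<ge> d + 1"
    and "X \<in> Gr (d + 1) n"
    and "generic d n X"
  shows "matroid_of_L d n X = dilworth_compl (n - d) n \<and>
    (\<forall>\<J> \<subseteq> nsets {1..n} d.
       \<J> \<in> indep (matroid_of_L d n X) \<longleftrightarrow>
       (\<forall>s>0. \<forall>\<S>\<subseteq>\<J>. card \<S> = s \<longrightarrow> int (card (\<Inter>\<S>)) \<le> int d + 1 - int s))"
proof (intro conjI allI impI)
  note iff = indep_matroid_of_L_iff[OF infinite_alg_closed assms(1,3)]
  have "ground (matroid_of_L d n X) = ground (dilworth_compl (n - d) n)"
    using ground_dilworth_compl[of "n - d" n] assms(1)
    by (simp add: matroid_of_L_def linear_matroid_def)
  moreover have "indep (matroid_of_L d n X) = indep (dilworth_compl (n - d) n)"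
    unfolding set_eq_iff iff indep_dilworth_compl_iff[OF assms(1)] by blast
  ultimately show "matroid_of_L d n X = dilworth_compl (n - d) n" by simp
  fix \<J> assume \<J>: "\<J> \<subseteq> nsets {1..n} d"
  then have "finite \<J>" by (rule finite_subset) (simp add: finite_imp_finite_nsets)
  then have pos: "card \<S> > 0 \<longleftrightarrow> \<S> \<noteq> {}" if "\<S> \<subseteq> \<J>" for \<S>
    using finite_subset[OF that] by (auto simp: card_gt_0_iff)
  \<comment> \<open>Over the integers \<open>d + 1 - s\<close> may be negative; the additive form
    carries the same bound to the natural numbers.\<close>
  have le: "int (card (\<Inter>\<S>)) \<le> int d + 1 - int (card \<S>) \<longleftrightarrow> card (\<Inter>\<S>) + card \<S> \<le> d + 1"
    for \<S> :: "nat set set" by linarith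
  have "(\<forall>s>0. \<forall>\<S>\<subseteq>\<J>. card \<S> = s \<longrightarrow> int (card (\<Inter>\<S>)) \<le> int d + 1 - int s) \<longleftrightarrow>
      (\<forall>\<S>\<subseteq>\<J>. card \<S> > 0 \<longrightarrow> int (card (\<Inter>\<S>)) \<le> int d + 1 - int (card \<S>))" by blast
  also have "\<dots> \<longleftrightarrow> (\<forall>\<S>\<subseteq>\<J>. \<S> \<noteq> {} \<longrightarrow> card (\<Inter>\<S>) + card \<S> \<le> d + 1)"
    unfolding le using pos by blast
  finally show "\<J> \<in> indep (matroid_of_L d n X) \<longleftrightarrow>
       (\<forall>s>0. \<forall>\<S>\<subseteq>\<J>. card \<S> = s \<longrightarrow> int (card (\<Inter>\<S>)) \<le> int d + 1 - int s)"
    unfolding iff using \<J> by simp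
qed

end
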